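(* Let $Z=(Z_t)_{t\ge 0}$ be a real-valued Lévy process without Gaussian component, with characteristic exponent $\psi$ and Lévy measure $\mu$ satisfying $\mu(\mathbb{R})=\infty$, and suppose that condition A holds, i.e. there exists $\beta>1$ such that $\psi^U(\xi)\le\beta\,\psi^L(\xi)$ for all $\xi\in\mathbb{R}$. Let $p_t$ be the distribution density of $Z_t$. Then for every $t_0>0$ there exist positive constants $b_1,b_2,b_3,b_4$ such that the following holds. I. The function $(t,x)\mapsto p_t(x-a_t)$, $(t,x)\in(0,t_0]\times\mathbb{R}$, satisfies the upper compound kernel estimate with parameters $(\rho_t,f_{upper},\rho_t,\Lambda_t)$, where $f_{upper}(x)=b_1e^{-b_2|x|}$. II. The function $(t,x)\mapsto p_t(x-a_t+x_t)$, $(t,x)\in(0,t_0]\times\mathbb{R}$, satisfies the lower compound kernel estimate with parameters $(\rho_t,f_{lower},\rho_t,\Lambda_t)$, where $f_{lower}(x)=b_3\mathbf 1_{|x|\le b_4}$.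
   Context: The characteristic exponent $\psi$ is defined by $E e^{i\xi Z_t}=e^{-t\psi(\xi)}$, $\xi\in\mathbb{R}$, and has the representation $$\psi(\xi)=ia\xi+\int_{\mathbb{R}}\bigl(1-e^{i\xi u}+i\xi u\mathbf 1_{|u|<1}\bigr)\mu(du),$$ where $a\in\mathbb{R}$ and $\mu$ is a Lévy measure ($\mu(\{0\})=0$, $\int_{\mathbb{R}}(1\wedge u^2)\mu(du)<\infty$). Define, for $\xi\in\mathbb{R}$, $$\psi^L(\xi)=\int_{|\xi u|<1}(\xi u)^2\mu(du),\qquad \psi^U(\xi)=\int_{\mathbb{R}}\bigl((\xi u)^2\wedge 1\bigr)\mu(du).$$ For $t>0$ put $\rho_t:=\inf\{\xi>0:\ \mathrm{Re}\,\psi(\xi)\ge 1/t\}$ (the set is nonempty under condition A), and $$\Lambda_t(du)=t\,\mathbf 1_{|\rho_tu|>1}\,\mu(du),\qquad a_t=t\Bigl(a+\int_{1/\rho_t<|u|<1}u\,\mu(du)\Bigr),$$ where, if $\rho_t<1$, the integral $\int_{1/\rho_t<|u|<1}u\,\mu(du)$ is understood as $-\int_{1\le|u|\le 1/\rho_t}u\,\mu(du)$. With these definitions $Z_t$ has the same law as $\bar Z_t+\hat Z_t-a_t$, where $\bar Z_t,\hat Z_t$ are independent, $\hat Z_t$ is compound Poisson with intensity measure $\Lambda_t$, and $\bar Z_t$ is infinitely divisible with $Ee^{i\xi\bar Z_t}=e^{-\psi_t(\xi)}$, $$\psi_t(\xi)=t\int_{|\rho_tu|\le 1}(1-e^{i\xi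 u}+i\xi u)\mu(du).$$ Under condition A both $Z_t$ and $\bar Z_t$ have smooth bounded densities, $p_t$ and $\bar p_t$ respectively, for every $t>0$, and $$x_t:=\min\Bigl\{x:\ \bar p_t(x)=\max_{x'\in\mathbb{R}}\bar p_t(x')\Bigr\}$$ is well defined. Compound kernel estimates: let $\sigma,\zeta:(0,\infty)\to\mathbb{R}$ and $h:\mathbb{R}\to\mathbb{R}$ be functions and $(Q_t)$ a family of finite Borel measures on $\mathbb{R}$. A real-valued function $g_t(x)$ defined on a set $A\subset(0,\infty)\times\mathbb{R}$ satisfies the upper compound kernel estimate with parameters $(\sigma_t,h,\zeta_t,Q_t)$ if $$g_t(x)\le\sum_{m=0}^\infty\frac1{m!}\int_{\mathbb{R}}\sigma_t\,h\bigl((x-y)\zeta_t\bigr)\,Q_t^{*m}(dy),\qquad (t,x)\in A,$$ where $Q_t^{*m}$ is the $m$-fold convolution power and $Q_t^{*0}=\delta_0$. It satisfies the lower compound kernel estimate with these parameters if the same holds with $\ge$ in place of $\le$.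
   Formalization: When ρ_t = 1, the integral in a_t is taken as −∫_{|u|=1} u μ(du) (the convention for ρ_t < 1 extended to ρ_t ≤ 1) rather than 0; with the value 0 the stated identity in law and Part II can fail if μ has unequal atoms at 1 and −1. *)

theory Defs
  imports "HOL-Probability.Probability"
begin

definition levy_process :: "'a measure \<Rightarrow> (real \<Rightarrow> 'a \<Rightarrow> real) \<Rightarrow> bool" where
  "levy_process M Z \<longleftrightarrow>
     prob_space M \<and>
     (\<forall>t\<ge>0. Z t \<in> borel_measurable M) \<and>
     (AE \<omega> in M. Z 0 \<omega> = 0) \<and>
     (\<forall>(s :: nat \<Rightarrow> real) n. 0 \<le> s 0 \<and> (\<forall>i<n. s i < s (Suc i)) \<longrightarrow>
        prob_space.indep_vars M (\<lambda>_. borel) (\<lambda>i \<omega>. Z (s (Suc i)) \<omega> - Z (s i) \<omega>) {..<n}) \<and>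
     (\<forall>s\<ge>0. \<forall>t\<ge>0. distr M borel (\<lambda>\<omega>. Z (s + t) \<omega> - Z s \<omega>) = distr M borel (Z t)) \<and>
     (\<forall>t\<ge>0. \<forall>\<epsilon>>0.
        ((\<lambda>s. measure M {\<omega> \<in> space M. \<bar>Z s \<omega> - Z t \<omega>\<bar> > \<epsilon>}) \<longlongrightarrow> 0) (at t within {0..}))"

definition levy_measure :: "real measure \<Rightarrow> bool" where
  "levy_measure \<mu> \<longleftrightarrow>
     sets \<mu> = sets borel \<and> emeasure \<mu> {0} = 0 \<and> (\<integral>\<^sup>+u. ennreal (min 1 (u\<^sup>2)) \<partial>\<mu>) < \<infinity>"

text \<open>The exponent \<open>\<psi>\<close> in the convention \<open>E exp (i \<xi> Z\<^sub>t) = exp (- t \<psi> \<xi>)\<close>, with no Gaussian part.\<close>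

definition psi :: "real \<Rightarrow> real measure \<Rightarrow> real \<Rightarrow> complex" where
  "psi a \<mu> \<xi> = \<i> * a * \<xi> +
     (\<integral>u. (1 - iexp (\<xi> * u) + \<i> * \<xi> * u * indicator {u. \<bar>u\<bar> < 1} u) \<partial>\<mu>)"

definition psiL :: "real measure \<Rightarrow> real \<Rightarrow> real" where
  "psiL \<mu> \<xi> = (LINT u:{u. \<bar>\<xi> * u\<bar> < 1}|\<mu>. (\<xi> * u)\<^sup>2)"

definition psiU :: "real measure \<Rightarrow> real \<Rightarrow> real" where
  "psiU \<mu> \<xi> = (LINT u|\<mu>. min ((\<xi> * u)\<^sup>2) 1)"

definition condition_A :: "real measure \<Rightarrow> bool" where
  "condition_A \<mu> \<longleftrightarrow> (\<exists>\<beta>>1. \<forall>\<xi>. psiU \<mu> \<xi> \<le> \<beta> * psiL \<mu> \<xi>)"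

definition rho :: "real \<Rightarrow> real measure \<Rightarrow> real \<Rightarrow> real" where
  "rho a \<mu> t = Inf {\<xi>. \<xi> > 0 \<and> Re (psi a \<mu> \<xi>) \<ge> 1 / t}"

definition Lambda :: "real \<Rightarrow> real measure \<Rightarrow> real \<Rightarrow> real measure" where
  "Lambda a \<mu> t = density \<mu> (\<lambda>u. ennreal (t * indicator {u. \<bar>rho a \<mu> t * u\<bar> > 1} u))"

text \<open>The centering \<open>a\<^sub>t\<close>. Both branches equal the integral of \<open>u\<close> times
  (indicator of \<open>\<bar>u\<bar> < 1\<close> minus indicator of \<open>\<bar>\<rho>\<^sub>t u\<bar> \<le> 1\<close>). This is what the decomposition of the law
  of \<open>Z\<^sub>t\<close> into the truncated part, the compound Poisson part and \<open>- a\<^sub>t\<close> requires. In the borderline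
  case \<open>\<rho>\<^sub>t = 1\<close> it is the second branch that does so: it accounts for possible atoms of \<open>\<mu>\<close>
  at 1 and -1.\<close>

definition centering :: "real \<Rightarrow> real measure \<Rightarrow> real \<Rightarrow> real" where
  "centering a \<mu> t = t * (a +
     (if rho a \<mu> t > 1
      then (LINT u:{u. 1 / rho a \<mu> t < \<bar>u\<bar> \<and> \<bar>u\<bar> < 1}|\<mu>. u)
      else - (LINT u:{u. 1 \<le> \<bar>u\<bar> \<and> \<bar>u\<bar> \<le> 1 / rho a \<mu> t}|\<mu>. u)))"

definition psi_trunc :: "real \<Rightarrow> real measure \<Rightarrow> real \<Rightarrow> real \<Rightarrow> complex" where
  "psi_trunc a \<mu> t \<xi> =
     t * (CLINT u:{u. \<bar>rho a \<mu> t * u\<bar> \<le> 1}|\<mu>. 1 - iexp (\<xi> * u) + \<i> * \<xi> * u)"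

text \<open>The law with characteristic function \<open>exp (- \<phi>)\<close>, unique by Levy's uniqueness theorem.\<close>

definition law_of_exponent :: "(real \<Rightarrow> complex) \<Rightarrow> real measure" where
  "law_of_exponent \<phi> = (THE N. real_distribution N \<and> (\<forall>\<xi>. char N \<xi> = exp (- \<phi> \<xi>)))"

text \<open>Densities are only determined almost everywhere; pointwise statements refer to the continuous
  version, of which there is at most one. Nonnegativity is explicit because \<^const>\<open>ennreal\<close> truncates
  negative values.\<close>

definition cont_density :: "real measure \<Rightarrow> real \<Rightarrow> real" where
  "cont_density N = (THE f. continuous_on UNIV f \<and> (\<forall>x. 0 \<le> f x) \<and>
     N = density lborel (\<lambda>x. ennreal (f x)))"

definition pbar :: "real \<Rightarrow> real measure \<Rightarrow> real \<Rightarrow> real \<Rightarrow> real" where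
  "pbar a \<mu> t = cont_density (law_of_exponent (psi_trunc a \<mu> t))"

definition mode_point :: "real \<Rightarrow> real measure \<Rightarrow> real \<Rightarrow> real" where
  "mode_point a \<mu> t = (LEAST x. \<forall>x'. pbar a \<mu> t x' \<le> pbar a \<mu> t x)"

primrec conv_power :: "real measure \<Rightarrow> nat \<Rightarrow> real measure" where
  "conv_power Q 0 = return borel 0"
| "conv_power Q (Suc m) = convolution Q (conv_power Q m)"

text \<open>For bounded Borel \<open>h\<close> and finite \<open>Q\<^sub>t\<close> all integrals exist and the series converges absolutely.\<close>

definition compound_kernel ::
  "(real \<Rightarrow> real) \<Rightarrow> (real \<Rightarrow> real) \<Rightarrow> (real \<Rightarrow> real) \<Rightarrow> (real \<Rightarrow> real measure) \<Rightarrow> real \<Rightarrow> real \<Rightarrow> real"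
where
  "compound_kernel \<sigma> h \<zeta> Q t x =
     (\<Sum>m. 1 / fact m * (LINT y|conv_power (Q t) m. \<sigma> t * h ((x - y) * \<zeta> t)))"

definition upper_compound_kernel_estimate ::
  "(real \<times> real) set \<Rightarrow> (real \<Rightarrow> real \<Rightarrow> real) \<Rightarrow>
   (real \<Rightarrow> real) \<Rightarrow> (real \<Rightarrow> real) \<Rightarrow> (real \<Rightarrow> real) \<Rightarrow> (real \<Rightarrow> real measure) \<Rightarrow> bool"
where
  "upper_compound_kernel_estimate A g \<sigma> h \<zeta> Q \<longleftrightarrow>
     (\<forall>(t, x)\<in>A. g t x \<le> compound_kernel \<sigma> h \<zeta> Q t x)"

definition lower_compound_kernel_estimate ::
  "(real \<times> real) set \<Rightarrow> (real \<Rightarrow> real \<Rightarrow> real) \<Rightarrow>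
   (real \<Rightarrow> real) \<Rightarrow> (real \<Rightarrow> real) \<Rightarrow> (real \<Rightarrow> real) \<Rightarrow> (real \<Rightarrow> real measure) \<Rightarrow> bool"
where
  "lower_compound_kernel_estimate A g \<sigma> h \<zeta> Q \<longleftrightarrow>
     (\<forall>(t, x)\<in>A. g t x \<ge> compound_kernel \<sigma> h \<zeta> Q t x)"

end

theory Submission
  imports Defs
begin

text \<open>
  At time \<open>t\<close> the jumps are cut at the level \<open>1 / \<rho>\<^sub>t\<close>, where \<open>\<rho>\<^sub>t\<close> solves \<open>Re \<psi>(\<rho>\<^sub>t) = 1 / t\<close>. The law of
  \<open>Z\<^sub>t + a\<^sub>t\<close> is then the convolution of the law of the compensated small jumps, with density \<open>q\<close>, and the
  compound Poisson law of the large jumps (\<open>exponent_decomposition\<close>). Hence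
  \<open>p\<^sub>t(x - a\<^sub>t)\<close> is the mean of \<open>q(x - y)\<close> under the compound Poisson law
  (\<open>cont_density_convolution_shift\<close>), and a compound kernel is a mean of the same kind
  (\<open>compound_kernel_eq_compound_poisson_integral\<close>), up to the factor \<open>exp \<Lambda>\<^sub>t(\<real>)\<close>. Since \<open>\<Lambda>\<^sub>t(\<real>)\<close> is at most
  \<open>4 * \<beta>\<close> (\<open>measure_Lambda_le\<close>), both estimates reduce to
  pointwise bounds of \<open>q\<close> that are uniform in \<open>t\<close> after rescaling by \<open>\<rho>\<^sub>t\<close>: an upper bound
  \<open>\<rho>\<^sub>t * b\<^sub>1 * exp (- \<bar>\<rho>\<^sub>t * x\<bar> / 2)\<close>, and a lower bound of order \<open>\<rho>\<^sub>t\<close> on a neighbourhood of the mode whose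
  radius is of order \<open>1 / \<rho>\<^sub>t\<close>.

  Three facts about the small jumps give these bounds. First, condition A forces \<open>\<psi>\<^sup>U\<close> to grow by a fixed
  factor \<open>\<theta> > 1\<close> whenever its argument doubles (\<open>psiU_geometric_growth\<close>), and
  \<open>Re \<psi>\<close> is comparable to \<open>\<psi>\<^sup>U\<close>. So the characteristic function of \<open>q\<close> at \<open>\<rho>\<^sub>t * s\<close> is bounded by
  \<open>K / (1 + s\<^sup>2)\<^sup>2\<close> (\<open>char_truncated_law_decay\<close>), and by Fourier inversion \<open>q\<close> is
  bounded by \<open>B * \<rho>\<^sub>t\<close> and Lipschitz with constant \<open>L * \<rho>\<^sub>t\<^sup>2\<close> (\<open>density_of_char_bound\<close>).
  Secondly, the small jumps have exponential moments at the scale \<open>\<rho>\<^sub>t\<close> (\<open>truncated_law\<close>). Thirdly, a density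
  with a Lipschitz bound and exponential moments decays exponentially (\<open>density_decay\<close>), and
  one with exponential moments has a peak of order \<open>\<rho>\<^sub>t\<close> (\<open>max_density_lower_bound\<close>), which the Lipschitz bound widens.

  The law of the small jumps is constructed as a limit of centred compound Poisson laws
  (\<open>compensated_law_exists\<close>), because only its exponent is given.
\<close>

section \<open>Densities with an integrable characteristic function\<close>

text \<open>This bounds the kernel of the inversion integral uniformly in \<open>t\<close>, so that
  \<open>\<bar>b - a\<bar>\<close> times the modulus of the characteristic function is a dominating function in the
  limits below. At \<open>t = 0\<close> the quotient is 0 because division by zero gives zero.\<close>

lemma norm_fourier_increment_le:
  fixes a b t :: real
  shows "cmod ((iexp (-(t * a)) - iexp (-(t * b))) / (\<i> * t)) \<le> \<bar>b - a\<bar>"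
proof (cases "t = 0")
  case t: False
  show ?thesis
  proof (cases "a \<le> b")
    case True
    then show ?thesis using Levy_Inversion_aux2[of "-b" "-a" t] t by simp
  next
    case False
    then show ?thesis using Levy_Inversion_aux2[of "-a" "-b" t] t
      by (simp add: norm_divide norm_minus_commute)
  qed
qed simp

text \<open>Levy's inversion formula is a principal value; when the characteristic function is integrable,
  dominated convergence turns it into an absolutely convergent integral.\<close>

lemma (in real_distribution) levy_inversion_integrable:
  assumes int: "integrable lborel (char M)" and "a \<le> b"
    and "measure M {a} = 0" "measure M {b} = 0"
  shows "complex_of_real (measure M {a<..b}) =
    1 / (2 * pi) * (CLBINT t. (iexp (-(t * a)) - iexp (-(t * b))) / (\<i> * t) * char M t)"
proof -
  let ?F = "\<lambda>t::real. (iexp (-(t * a)) - iexp (-(t * b))) / (\<i> * t) * char M t"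
  have Fb: "norm (?F t) \<le> (b - a) * norm (char M t)" for t
    unfolding norm_mult using norm_fourier_increment_le[of t a b] \<open>a \<le> b\<close> by (intro mult_right_mono) auto
  have lim1: "((\<lambda>T::real. CLBINT t=ereal (-T)..ereal T. ?F t) \<longlongrightarrow> (CLBINT t. ?F t)) at_top"
  proof (rule Lim_transform_eventually)
    show "((\<lambda>T::real. CLBINT t. indicator {-T..T} t *\<^sub>R ?F t) \<longlongrightarrow> (CLBINT t. ?F t)) at_top"
    proof (rule integral_dominated_convergence_at_top[where w = "\<lambda>t. (b - a) * norm (char M t)"])
      show "integrable lborel (\<lambda>t. (b - a) * norm (char M t))" using int by auto
      show "AE t in lborel. ((\<lambda>T. indicator {-T..T} t *\<^sub>R ?F t) \<longlongrightarrow> ?F t) at_top"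
      proof (rule AE_I2)
        fix t :: real
        have "eventually (\<lambda>T. ?F t = indicator {-T..T} t *\<^sub>R ?F t) at_top"
          using eventually_ge_at_top[of "\<bar>t\<bar>"] by eventually_elim (simp add: abs_le_iff)
        then show "((\<lambda>T. indicator {-T..T} t *\<^sub>R ?F t) \<longlongrightarrow> ?F t) at_top"
          by (rule Lim_transform_eventually[rotated]) simp
      qed
      show "\<forall>\<^sub>F T in at_top. AE t in lborel. norm (indicator {-T..T} t *\<^sub>R ?F t) \<le> (b - a) * norm (char M t)"
      proof (rule always_eventually, rule allI, rule AE_I2)
        fix T t :: real
        have "norm (indicator {-T..T} t *\<^sub>R z) \<le> norm z" for z :: complex
          by (auto split: split_indicator)
        from order_trans[OF this Fb]
        show "norm (indicator {-T..T} t *\<^sub>R ?F t) \<le> (b - a) * norm (char M t)" .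
      qed
    qed measurable
    show "\<forall>\<^sub>F T::real in at_top. (CLBINT t. indicator {-T..T} t *\<^sub>R ?F t) = (CLBINT t=ereal (-T)..ereal T. ?F t)"
      using eventually_ge_at_top[of 0]
    proof eventually_elim
      case (elim T)
      then have "(CLBINT t=ereal (-T)..ereal T. ?F t) = (CLBINT t:{-T..T}. ?F t)"
        using interval_integral_Icc[of "-T" T ?F] by auto
      then show ?case unfolding set_lebesgue_integral_def by simp
    qed
  qed
  have seq: "filterlim real at_top sequentially" by (rule filterlim_real_sequentially)
  have "((\<lambda>T::nat. 1 / (2 * pi) * (CLBINT t=ereal (-real T)..ereal T. ?F t)) \<longlonglongrightarrow> 1 / (2 * pi) * (CLBINT t. ?F t))"
    using filterlim_compose[OF lim1 seq] by (intro tendsto_intros) simp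
  moreover have "(\<lambda>T::nat. 1 / (2 * pi) * (CLBINT t=ereal (-real T)..ereal T. ?F t)) \<longlonglongrightarrow> measure M {a<..b}"
    using Levy_Inversion[OF assms(2-4)] by simp
  ultimately show ?thesis by (rule LIMSEQ_unique[rotated])
qed

text \<open>The inversion formula at continuity points bounds the mass of an interval by a constant times its
  length. Since there are at most countably many atoms, every point lies in arbitrarily short
  intervals with admissible endpoints.\<close>

lemma (in real_distribution) no_atoms_if_integrable_char:
  assumes int: "integrable lborel (char M)"
  shows "measure M {x} = 0"
proof -
  define B where "B = 1 / (2 * pi) * (LBINT t. norm (char M t))"
  have B0: "B \<ge> 0" unfolding B_def by (auto intro!: mult_nonneg_nonneg integral_nonneg)
  have cnt: "countable {x. measure M {x} \<noteq> 0}" by (rule countable_support)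
  have "measure M {x} \<le> e" if "e > 0" for e
  proof -
    \<comment> \<open>chosen so that an interval of length \<open>2 * d\<close> has mass at most \<open>e\<close>; the \<open>+ 1\<close> guards against \<open>B = 0\<close>\<close>
    define d where "d = e / (2 * (B + 1))"
    have d: "d > 0" using that B0 by (auto simp: d_def)
    from open_minus_countable[OF cnt, of "{x - d<..<x}"] d obtain a where
      a: "x - d < a" "a < x" "measure M {a} = 0" by force
    from open_minus_countable[OF cnt, of "{x<..<x + d}"] d obtain b where
      b: "x < b" "b < x + d" "measure M {b} = 0" by force
    let ?F = "\<lambda>t::real. (iexp (-(t * a)) - iexp (-(t * b))) / (\<i> * t) * char M t"
    have Fb: "norm (?F t) \<le> (b - a) * norm (char M t)" for t
      unfolding norm_mult using norm_fourier_increment_le[of t a b] a b by (intro mult_right_mono) auto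
    have "measure M {x} \<le> measure M {a<..b}"
      using a b by (intro finite_measure_mono) auto
    also have "\<dots> = norm (complex_of_real (measure M {a<..b}))" by simp
    also have "\<dots> = 1 / (2 * pi) * norm (CLBINT t. ?F t)"
      using a b by (subst levy_inversion_integrable[OF int]) (auto simp: norm_mult norm_divide)
    also have "norm (CLBINT t. ?F t) \<le> (LBINT t. (b - a) * norm (char M t))"
      by (rule order_trans[OF integral_norm_bound integral_mono_AE'])
         (use int Fb a b in \<open>auto intro!: mult_nonneg_nonneg\<close>)
    also have "1 / (2 * pi) * (LBINT t. (b - a) * norm (char M t)) = (b - a) * B"
      by (simp add: B_def)
    also have "\<dots> \<le> (2 * d) * B" using a b B0 by (intro mult_right_mono) auto
    also have "\<dots> \<le> e" using B0 that by (simp add: d_def field_simps)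
    finally show ?thesis by (simp add: divide_right_mono)
  qed
  then have "measure M {x} \<le> 0" by (rule dense_ge)
  then show ?thesis using measure_nonneg[of M "{x}"] by simp
qed

text \<open>With no atoms, the inversion formula expresses every increment of the distribution function.
  Its difference quotients converge under the integral, so the density can be read off as an
  ordinary derivative.\<close>

lemma (in real_distribution) cdf_has_derivative_inverse_fourier:
  assumes int: "integrable lborel (char M)"
  shows "(cdf M has_real_derivative Re (1 / (2 * pi) * (CLBINT t. iexp (-(t * x)) * char M t))) (at x)"
proof -
  let ?F = "\<lambda>a b (t::real). (iexp (-(t * a)) - iexp (-(t * b))) / (\<i> * t) * char M t"
  let ?q = "1 / (2 * pi) * (CLBINT t. iexp (-(t * x)) * char M t)"
  have pos: "complex_of_real (cdf M b - cdf M a) = 1 / (2 * pi) * (CLBINT t. ?F a b t)" if "a \<le> b" for a b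
  proof (cases "a = b")
    case False
    then show ?thesis
      using levy_inversion_integrable[OF int that] no_atoms_if_integrable_char[OF int] that
      by (subst cdf_diff_eq) auto
  qed simp
  have all: "complex_of_real (cdf M b - cdf M a) = 1 / (2 * pi) * (CLBINT t. ?F a b t)" for a b
  proof (cases "a \<le> b")
    case False
    have "complex_of_real (cdf M b - cdf M a) = - complex_of_real (cdf M a - cdf M b)" by simp
    also have "\<dots> = - (1 / (2 * pi) * (CLBINT t. ?F b a t))" using False by (subst pos) auto
    also have "\<dots> = 1 / (2 * pi) * (CLBINT t. - ?F b a t)" by simp
    also have "(\<lambda>t. - ?F b a t) = ?F a b"
      by (rule ext) (metis (no_types, lifting) minus_diff_eq minus_divide_left minus_mult_left)
    finally show ?thesis .
  qed (rule pos)
  have "(\<lambda>n. (cdf M (x + h n) - cdf M x) / h n) \<longlonglongrightarrow> Re ?q"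
    if h: "h \<longlonglongrightarrow> 0" "\<And>n. h n \<noteq> 0" for h :: "nat \<Rightarrow> real"
  proof -
    have "(\<lambda>n. CLBINT t. ?F x (x + h n) t / h n) \<longlonglongrightarrow> (CLBINT t. iexp (-(t * x)) * char M t)"
    proof (rule integral_dominated_convergence[where w = "\<lambda>t. norm (char M t)"])
      show "integrable lborel (\<lambda>t. norm (char M t))" using int by auto
      show "AE t in lborel. norm (?F x (x + h n) t / h n) \<le> norm (char M t)" for n
      proof (rule AE_I2)
        fix t :: real
        have *: "norm ((iexp (-(t * x)) - iexp (-(t * (x + h n)))) / (\<i> * t)) \<le> \<bar>h n\<bar>"
          using norm_fourier_increment_le[of t x "x + h n"] by simp
        have "norm (?F x (x + h n) t / h n) =
          norm ((iexp (-(t * x)) - iexp (-(t * (x + h n)))) / (\<i> * t)) / \<bar>h n\<bar> * norm (char M t)"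
          by (simp add: norm_mult norm_divide)
        also have "\<dots> \<le> 1 * norm (char M t)"
          using * h(2)[of n] by (intro mult_right_mono) (auto simp: field_simps)
        finally show "norm (?F x (x + h n) t / h n) \<le> norm (char M t)" by simp
      qed
      show "AE t in lborel. (\<lambda>n. ?F x (x + h n) t / h n) \<longlonglongrightarrow> iexp (-(t * x)) * char M t"
      proof (rule AE_mp[OF AE_lborel_singleton[of 0]], rule AE_I2, rule impI)
        fix t :: real assume t: "t \<noteq> 0"
        have "((\<lambda>z. (exp z - 1) / z) \<longlongrightarrow> (1::complex)) (at 0)"
          using DERIV_exp[of "0::complex"] unfolding has_field_derivative_iff by simp
        moreover have "filterlim (\<lambda>n. \<i> * complex_of_real (- (t * h n))) (at 0) sequentially"
          using h t by (auto simp: filterlim_at intro!: tendsto_eq_intros)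
        ultimately have L: "(\<lambda>n. (exp (\<i> * complex_of_real (- (t * h n))) - 1) / (\<i> * complex_of_real (- (t * h n)))) \<longlonglongrightarrow> 1"
          by (rule filterlim_compose)
        have "(\<lambda>n. iexp (-(t * x)) * char M t * ((exp (\<i> * complex_of_real (- (t * h n))) - 1) / (\<i> * complex_of_real (- (t * h n)))))
          \<longlonglongrightarrow> iexp (-(t * x)) * char M t * 1"
          by (intro tendsto_intros L)
        moreover have "iexp (-(t * x)) * char M t * ((exp (\<i> * complex_of_real (- (t * h n))) - 1) / (\<i> * complex_of_real (- (t * h n))))
           = ?F x (x + h n) t / h n" for n
        proof -
          have "iexp (-(t * (x + h n))) = iexp (-(t * x)) * iexp (-(t * h n))"
            by (simp add: exp_add[symmetric] algebra_simps)
          then show ?thesis using t h(2)[of n] by (simp add: divide_simps) (simp add: algebra_simps)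
        qed
        ultimately show "(\<lambda>n. ?F x (x + h n) t / h n) \<longlonglongrightarrow> iexp (-(t * x)) * char M t"
          by simp
      qed
    qed simp_all
    then have "(\<lambda>n. Re (1 / (2 * pi) * (CLBINT t. ?F x (x + h n) t / h n))) \<longlonglongrightarrow> Re ?q"
      by (intro tendsto_intros)
    moreover have "Re (1 / (2 * pi) * (CLBINT t. ?F x (x + h n) t / h n)) = (cdf M (x + h n) - cdf M x) / h n" for n
    proof -
      have "1 / (2 * pi) * (CLBINT t. ?F x (x + h n) t / h n) = 1 / (2 * pi) * (CLBINT t. ?F x (x + h n) t) / h n"
        by (subst Bochner_Integration.integral_divide_zero) (rule times_divide_eq_right)
      also have "\<dots> = complex_of_real ((cdf M (x + h n) - cdf M x) / h n)"
        by (subst all[symmetric]) simp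
      finally show ?thesis by simp
    qed
    ultimately show ?thesis by simp
  qed
  then show ?thesis
    unfolding DERIV_def tendsto_at_iff_sequentially by (auto simp: comp_def)
qed

text \<open>Bounds on the density come from the modulus of the characteristic function, bounds on its
  increments from the first absolute moment of that modulus. The factor \<open>1 / (2 * pi)\<close> is dropped.\<close>

lemma (in real_distribution) fourier_density:
  assumes int: "integrable lborel (char M)" and int1: "integrable lborel (\<lambda>t. \<bar>t\<bar> * norm (char M t))"
  obtains q where "continuous_on UNIV q" "\<And>x. 0 \<le> q x" "M = density lborel (\<lambda>x. ennreal (q x))"
    "\<And>x. q x \<le> (LBINT t. norm (char M t))"
    "\<And>x y. \<bar>q x - q y\<bar> \<le> (LBINT t. \<bar>t\<bar> * norm (char M t)) * \<bar>x - y\<bar>"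
proof -
  define q where "q x = Re (1 / (2 * pi) * (CLBINT t. iexp (-(t * x)) * char M t))" for x
  have der: "(cdf M has_real_derivative q x) (at x)" for x
    unfolding q_def by (rule cdf_has_derivative_inverse_fourier[OF int])
  have I: "integrable lborel (\<lambda>t. iexp (-(t * x)) * char M t)" for x
    by (rule Bochner_Integration.integrable_bound[OF int]) (auto simp: norm_mult)
  have pi1: "1 / (2 * pi) \<le> 1" using pi_gt3 by simp
  have nn: "q x \<ge> 0" for x
  proof -
    have "mono_on UNIV (cdf M)" by (auto simp: mono_on_def intro: cdf_nondecreasing)
    then show ?thesis using der[of x] by (intro mono_on_imp_deriv_nonneg[of UNIV "cdf M" "q x" x]) auto
  qed
  have Re1: "\<bar>Re (1 / (2 * pi) * z)\<bar> \<le> norm z" for z :: complex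
  proof -
    have "\<bar>Re (1 / (2 * pi) * z)\<bar> \<le> norm (1 / (2 * pi) * z)" by (rule abs_Re_le_cmod)
    also have "\<dots> = 1 / (2 * pi) * norm z" by (simp add: norm_mult norm_divide)
    also have "\<dots> \<le> 1 * norm z" using pi1 by (intro mult_right_mono) auto
    finally show ?thesis by simp
  qed
  have bd: "q x \<le> (LBINT t. norm (char M t))" for x
  proof -
    have "q x \<le> norm (CLBINT t. iexp (-(t * x)) * char M t)"
      unfolding q_def using Re1 abs_le_D1 by blast
    also have "\<dots> \<le> (LBINT t. norm (iexp (-(t * x)) * char M t))" by (rule integral_norm_bound)
    also have "\<dots> = (LBINT t. norm (char M t))" by (simp add: norm_mult)
    finally show ?thesis .
  qed
  have lip: "\<bar>q x - q y\<bar> \<le> (LBINT t. \<bar>t\<bar> * norm (char M t)) * \<bar>x - y\<bar>" for x y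
  proof -
    have "q x - q y = Re (1 / (2 * pi) * (CLBINT t. iexp (-(t * x)) * char M t - iexp (-(t * y)) * char M t))"
      unfolding q_def using I by (subst Bochner_Integration.integral_diff) (auto simp: right_diff_distrib)
    also have "\<bar>\<dots>\<bar> \<le> norm (CLBINT t. iexp (-(t * x)) * char M t - iexp (-(t * y)) * char M t)" by (rule Re1)
    also have "\<dots> \<le> (LBINT t. (\<bar>t\<bar> * norm (char M t)) * \<bar>x - y\<bar>)"
    proof (rule order_trans[OF integral_norm_bound integral_mono_AE'])
      show "AE t in lborel. norm (iexp (-(t * x)) * char M t - iexp (-(t * y)) * char M t) \<le> \<bar>t\<bar> * norm (char M t) * \<bar>x - y\<bar>"
      proof (rule AE_I2)
        fix t :: real
        have "iexp (-(t * x)) * char M t - iexp (-(t * y)) * char M t =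
           iexp (-(t * y)) * (iexp (t * (y - x)) - 1) * char M t"
          by (simp add: algebra_simps exp_add[symmetric] mult_exp_exp)
        then have "norm (iexp (-(t * x)) * char M t - iexp (-(t * y)) * char M t) = norm (iexp (t * (y - x)) - 1) * norm (char M t)"
          by (simp add: norm_mult)
        also have "\<dots> \<le> \<bar>t * (y - x)\<bar> * norm (char M t)"
          using iexp_approx1[of "t * (y - x)" 0] by (intro mult_right_mono) (auto simp: field_simps)
        also have "\<dots> = \<bar>t\<bar> * norm (char M t) * \<bar>x - y\<bar>"
          by (simp add: abs_mult abs_minus_commute)
        finally show "norm (iexp (-(t * x)) * char M t - iexp (-(t * y)) * char M t) \<le> \<bar>t\<bar> * norm (char M t) * \<bar>x - y\<bar>" .
      qed
    qed (use int1 in auto)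
    finally show ?thesis by simp
  qed
  have cont: "continuous_on UNIV q"
    by (rule lipschitz_on_continuous_on[of "LBINT t. \<bar>t\<bar> * norm (char M t)"])
       (auto simp: lipschitz_on_def dist_real_def lip intro!: integral_nonneg)
  have meas: "q \<in> borel_measurable borel" by (rule borel_measurable_continuous_onI[OF cont])
  have "M = density lborel (\<lambda>x. ennreal (q x))"
  proof (rule measure_eqI_generator_eq[where E = "range (\<lambda>(a, b). {a<..b::real})" and \<Omega> = UNIV and A = "\<lambda>n. {- real n<..real n}"])
    show "Int_stable (range (\<lambda>(a, b). {a<..b::real}))"
      by (auto simp: Int_stable_def Int_greaterThanAtMost)
    show "sets M = sigma_sets UNIV (range (\<lambda>(a, b). {a<..b::real}))"
      using borel_sigma_sets_Ioc by (metis M_is_borel sets_measure_of top_greatest Pow_UNIV)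
    show "sets (density lborel (\<lambda>x. ennreal (q x))) = sigma_sets UNIV (range (\<lambda>(a, b). {a<..b::real}))"
      using borel_sigma_sets_Ioc by (metis sets_density sets_lborel sets_measure_of top_greatest Pow_UNIV)
    show "(\<Union>n. {- real n<..real n}) = UNIV"
      by (rule UN_Ioc_eq_UNIV)
    fix X assume "X \<in> range (\<lambda>(a, b). {a<..b::real})"
    then obtain a b where X: "X = {a<..b}" by auto
    show "emeasure M X = emeasure (density lborel (\<lambda>x. ennreal (q x))) X"
    proof (cases "a < b")
      case True
      have "emeasure (density lborel (\<lambda>x. ennreal (q x))) X = (\<integral>\<^sup>+x. ennreal (q x) * indicator {a<..b} x \<partial>lborel)"
        unfolding X using meas by (subst emeasure_density) auto
      also have "\<dots> = (\<integral>\<^sup>+x. ennreal (q x) * indicator {a..b} x \<partial>lborel)"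
        by (rule nn_integral_cong_AE, rule AE_mp[OF AE_lborel_singleton[of a]]) (auto split: split_indicator)
      also have "\<dots> = ennreal (cdf M b - cdf M a)"
        using True der nn meas by (intro nn_integral_FTC_Icc) auto
      also have "\<dots> = emeasure M X"
        using True cdf_diff_eq[of a b] unfolding X emeasure_eq_measure by simp
      finally show ?thesis by simp
    qed (auto simp: X)
  qed auto
  then show ?thesis using that[of q] cont nn bd lip by auto
qed

text \<open>Exponential decay follows from a Lipschitz bound and exponential moments: if \<open>q x = h\<close>, then \<open>q\<close> is at least \<open>h / 2\<close> on an interval around \<open>x\<close> of radius
  proportional to \<open>h\<close>, so this interval carries mass proportional to \<open>h\<^sup>2\<close>, which the exponential
  moment bounds by a multiple of \<open>exp (- r * \<bar>x\<bar>)\<close>. The square root costs half of the exponent.\<close>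

lemma density_decay:
  assumes N: "real_distribution N" "N = density lborel (\<lambda>x. ennreal (q x))"
    and meas: "q \<in> borel_measurable borel" and nn: "\<And>x. 0 \<le> q x" and r: "r > 0" and pos: "B > 0" "L > 0" "E \<ge> 0"
    and bd: "\<And>x. q x \<le> B * r" and lip: "\<And>x y. \<bar>q x - q y\<bar> \<le> L * r\<^sup>2 * \<bar>x - y\<bar>"
    and mom: "(\<integral>\<^sup>+x. exp (r * x) \<partial>N) \<le> ennreal E" "(\<integral>\<^sup>+x. exp (- r * x) \<partial>N) \<le> ennreal E"
  shows "q x \<le> r * (sqrt (2 * L * E * exp (B / (2 * L))) * exp (- (\<bar>r * x\<bar> / 2)))"
proof -
  interpret real_distribution N by fact
  define h where "h = q x"
  \<comment> \<open>moving by at most \<open>d\<close> changes \<open>q\<close> by at most \<open>h / 2\<close>\<close>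
  define d where "d = h / (2 * L * r\<^sup>2)"
  have h0: "h \<ge> 0" using nn by (simp add: h_def)
  have d0: "d \<ge> 0" using h0 r pos by (simp add: d_def)
  have rd: "r * d \<le> B / (2 * L)"
  proof -
    have "r * d = h / (2 * L * r)" using r by (simp add: d_def power2_eq_square)
    also have "\<dots> \<le> B * r / (2 * L * r)" using bd[of x] r pos by (intro divide_right_mono) (auto simp: h_def)
    finally show ?thesis using r by simp
  qed
  \<comment> \<open>\<open>s\<close> selects the exponential moment on the side of \<open>x\<close>\<close>
  obtain s where s: "s = 1 \<or> s = (-1::real)" "\<bar>x\<bar> = s * x" using that[of 1] that[of "-1"] by (cases "x \<ge> 0") auto
  have mom': "(\<integral>\<^sup>+x. exp (s * r * x) \<partial>N) \<le> ennreal E" using mom s(1) by auto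
  have "ennreal (h\<^sup>2 / (2 * L * r\<^sup>2)) * ennreal (exp (r * (\<bar>x\<bar> - d))) \<le> ennreal E"
  proof -
    have "ennreal (h\<^sup>2 / (2 * L * r\<^sup>2)) * ennreal (exp (r * (\<bar>x\<bar> - d))) =
       ennreal (h / 2 * exp (r * (\<bar>x\<bar> - d))) * ennreal (2 * d)"
      using h0 d0 r pos by (simp add: ennreal_mult[symmetric] d_def field_simps power2_eq_square)
    also have "\<dots> = (\<integral>\<^sup>+y. ennreal (h / 2 * exp (r * (\<bar>x\<bar> - d))) * indicator {x - d..x + d} y \<partial>lborel)"
      using d0 by (subst nn_integral_cmult_indicator) auto
    also have "\<dots> \<le> (\<integral>\<^sup>+y. ennreal (q y) * ennreal (exp (s * r * y)) \<partial>lborel)"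
    proof (rule nn_integral_mono)
      fix y
      show "ennreal (h / 2 * exp (r * (\<bar>x\<bar> - d))) * indicator {x - d..x + d} y \<le> ennreal (q y) * ennreal (exp (s * r * y))"
      proof (cases "y \<in> {x - d..x + d}")
        case True
        then have xy: "\<bar>x - y\<bar> \<le> d" by auto
        have "h - q y \<le> L * r\<^sup>2 * \<bar>x - y\<bar>" using lip[of x y] by (simp add: h_def)
        also have "\<dots> \<le> L * r\<^sup>2 * d" using xy pos by (intro mult_left_mono) auto
        also have "\<dots> = h / 2" using pos r by (simp add: d_def)
        finally have q: "h / 2 \<le> q y" by simp
        have "\<bar>x\<bar> - d \<le> s * y" using xy s by auto
        then have "r * (\<bar>x\<bar> - d) \<le> r * (s * y)" using r by (intro mult_left_mono) auto
        then have "h / 2 * exp (r * (\<bar>x\<bar> - d)) \<le> q y * exp (s * r * y)"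
          using q h0 nn by (intro mult_mono) (auto simp: mult_ac)
        then show ?thesis using True nn by (simp add: ennreal_mult[symmetric] ennreal_leI)
      qed simp
    qed
    also have "\<dots> = (\<integral>\<^sup>+y. exp (s * r * y) \<partial>N)"
      unfolding N(2) using meas by (subst nn_integral_density) auto
    finally show ?thesis using mom' by (rule order_trans)
  qed
  then have "h\<^sup>2 / (2 * L * r\<^sup>2) * exp (r * (\<bar>x\<bar> - d)) \<le> E"
    using pos by (simp add: ennreal_mult[symmetric])
  then have "h\<^sup>2 * exp (r * (\<bar>x\<bar> - d)) \<le> E * (2 * L * r\<^sup>2)"
    using pos r by (simp add: field_simps)
  then have "h\<^sup>2 * exp (r * (\<bar>x\<bar> - d)) * (exp (r * d) * exp (- r * \<bar>x\<bar>)) \<le> E * (2 * L * r\<^sup>2) * (exp (r * d) * exp (- r * \<bar>x\<bar>))"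
    by (intro mult_right_mono) auto
  moreover have "exp (r * (\<bar>x\<bar> - d)) * (exp (r * d) * exp (- r * \<bar>x\<bar>)) = 1"
    by (simp add: mult_exp_exp algebra_simps)
  ultimately have "h\<^sup>2 * 1 \<le> E * (2 * L * r\<^sup>2) * (exp (r * d) * exp (- r * \<bar>x\<bar>))"
    by (simp only: mult.assoc)
  then have "h\<^sup>2 \<le> E * (2 * L * r\<^sup>2) * (exp (r * d) * exp (- r * \<bar>x\<bar>))" by simp
  also have "\<dots> \<le> E * (2 * L * r\<^sup>2) * (exp (B / (2 * L)) * exp (- r * \<bar>x\<bar>))"
    using rd pos by (intro mult_left_mono mult_right_mono) auto
  also have "\<dots> = r\<^sup>2 * ((2 * L * E * exp (B / (2 * L))) * (exp (- (\<bar>r * x\<bar> / 2)))\<^sup>2)"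
    using r by (simp add: power2_eq_square mult_exp_exp abs_mult field_simps)
  finally have "sqrt (h\<^sup>2) \<le> sqrt (r\<^sup>2 * ((2 * L * E * exp (B / (2 * L))) * (exp (- (\<bar>r * x\<bar> / 2)))\<^sup>2))"
    by (rule real_sqrt_le_mono)
  also have "\<dots> = r * (sqrt (2 * L * E * exp (B / (2 * L))) * exp (- (\<bar>r * x\<bar> / 2)))"
    using r by (simp add: real_sqrt_mult)
  finally show ?thesis using h0 by (simp add: h_def)
qed

text \<open>Two continuous densities of the same measure agree almost everywhere, and the set where they
  differ is open, hence empty.\<close>

lemma cont_density_eqI:
  assumes f: "continuous_on UNIV f" "\<And>x. 0 \<le> f x" and N: "N = density lborel (\<lambda>x. ennreal (f x))"
  shows "cont_density N = f"
  unfolding cont_density_def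
proof (rule the_equality)
  show "continuous_on UNIV f \<and> (\<forall>x. 0 \<le> f x) \<and> N = density lborel (\<lambda>x. ennreal (f x))"
    using assms by auto
  fix g assume g: "continuous_on UNIV g \<and> (\<forall>x. 0 \<le> g x) \<and> N = density lborel (\<lambda>x. ennreal (g x))"
  have m: "f \<in> borel_measurable borel" "g \<in> borel_measurable borel"
    using f g by (auto intro: borel_measurable_continuous_onI)
  have "AE x in lborel. ennreal (g x) = ennreal (f x)"
    using m g N by (subst sigma_finite_measure.density_unique_iff[OF sigma_finite_lborel, symmetric]) auto
  then have "AE x in lborel. g x = f x"
    by eventually_elim (use f g in auto)
  then have "{x. g x \<noteq> f x} \<in> null_sets lborel"
    using m by (subst AE_iff_null_sets) auto
  then have "negligible {x. g x \<noteq> f x}"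
    by (simp add: negligible_iff_null_sets null_sets_completionI)
  moreover have "open {x. g x \<noteq> f x}"
    using f g by (intro open_Collect_neq) auto
  ultimately have "{x. g x \<noteq> f x} = {}" using open_not_negligible by blast
  then show "g = f" by auto
qed

section \<open>Compound Poisson laws\<close>

lemma char_convolution:
  assumes "finite_measure A" "finite_measure B" and [measurable_cong]: "sets A = sets borel" "sets B = sets borel"
  shows "char (A \<star> B) \<xi> = char A \<xi> * char B \<xi>"
proof -
  interpret A: finite_measure A by fact
  interpret B: finite_measure B by fact
  interpret pair_sigma_finite A B ..
  interpret AB: finite_measure "A \<Otimes>\<^sub>M B" by (rule finite_measure_pair_measure) fact+
  have "char (A \<star> B) \<xi> = (CLINT z|A \<Otimes>\<^sub>M B. iexp (\<xi> * (fst z + snd z)))"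
    unfolding char_def convolution_def
    by (subst integral_distr) (auto simp: case_prod_beta)
  also have "\<dots> = (CLINT x|A. CLINT y|B. iexp (\<xi> * (x + y)))"
    by (subst integral_fst'[symmetric]) (auto intro!: AB.integrable_const_bound[where B=1] simp: case_prod_beta)
  also have "\<dots> = (CLINT x|A. iexp (\<xi> * x) * char B \<xi>)"
    unfolding char_def
    by (simp add: ring_distribs exp_add flip: mult_exp_exp)
  also have "\<dots> = char A \<xi> * char B \<xi>" by (simp add: char_def)
  finally show ?thesis .
qed

text \<open>Written as a sum over unnormalised convolution powers, which covers total mass 0 and matches the
  series of the compound kernel term by term.\<close>

definition compound_poisson :: "real measure \<Rightarrow> real measure" where
  "compound_poisson Q = measure_of UNIV (sets borel)
     (\<lambda>A. \<Sum>m. ennreal (exp (- measure Q UNIV) / fact m) * emeasure (conv_power Q m) A)"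

context
  fixes Q :: "real measure"
  assumes finite_Q: "finite_measure Q" and sets_Q[measurable_cong]: "sets Q = sets borel"
begin

lemma sets_conv_power[measurable_cong]: "sets (conv_power Q m) = sets borel"
  by (cases m) simp_all

lemma space_conv_power: "space (conv_power Q m) = UNIV"
  using sets_conv_power[of m, THEN sets_eq_imp_space_eq] by simp

lemma finite_conv_power: "finite_measure (conv_power Q m)"
proof (induction m)
  case (Suc m)
  then show ?case using finite_Q sets_Q sets_conv_power[of m] by (auto intro!: convolution_finite)
qed (auto intro!: prob_space.finite_measure prob_space_return)

text \<open>Exponentials turn convolution into multiplication. The case \<open>s = 0\<close> gives the total mass.\<close>

lemma nn_integral_exp_conv_power:
  "(\<integral>\<^sup>+x. ennreal (exp (s * x)) \<partial>conv_power Q m) = (\<integral>\<^sup>+x. ennreal (exp (s * x)) \<partial>Q) ^ m"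
proof (induction m)
  case 0
  show ?case by (simp add: nn_integral_return)
next
  case (Suc m)
  have "(\<integral>\<^sup>+x. ennreal (exp (s * x)) \<partial>conv_power Q (Suc m)) =
    (\<integral>\<^sup>+x. \<integral>\<^sup>+y. ennreal (exp (s * x)) * ennreal (exp (s * y)) \<partial>conv_power Q m \<partial>Q)"
    using finite_Q finite_conv_power[of m] sets_Q sets_conv_power[of m]
    by (simp add: nn_integral_convolution ring_distribs exp_add ennreal_mult)
  also have "\<dots> = (\<integral>\<^sup>+x. ennreal (exp (s * x)) \<partial>Q) * (\<integral>\<^sup>+x. ennreal (exp (s * x)) \<partial>conv_power Q m)"
    using sets_Q sets_conv_power[of m] by (simp add: nn_integral_cmult nn_integral_multc)
  finally show ?case using Suc.IH by simp
qed

lemma emeasure_conv_power_UNIV: "emeasure (conv_power Q m) UNIV = ennreal (measure Q UNIV ^ m)"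
proof -
  interpret finite_measure Q by (rule finite_Q)
  have "space Q = UNIV" using sets_Q[THEN sets_eq_imp_space_eq] by simp
  then show ?thesis
    using nn_integral_exp_conv_power[where s=0 and m=m]
    by (simp add: nn_integral_const space_conv_power emeasure_eq_measure ennreal_power)
qed

lemma char_conv_power: "char (conv_power Q m) \<xi> = char Q \<xi> ^ m"
proof (induction m)
  case 0
  show ?case by (simp add: char_def integral_return)
next
  case (Suc m)
  then show ?case
    using finite_Q finite_conv_power[of m] sets_Q sets_conv_power[of m] by (simp add: char_convolution)
qed

lemma sets_compound_poisson[simp, measurable_cong]: "sets (compound_poisson Q) = sets borel"
  unfolding compound_poisson_def by (subst sets_measure_of) (auto simp: sets.sigma_sets_eq[of borel, simplified])

lemma space_compound_poisson[simp]: "space (compound_poisson Q) = UNIV"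
  unfolding compound_poisson_def by (subst space_measure_of) auto

lemma emeasure_compound_poisson:
  assumes "A \<in> sets borel"
  shows "emeasure (compound_poisson Q) A =
    (\<Sum>m. ennreal (exp (- measure Q UNIV) / fact m) * emeasure (conv_power Q m) A)"
proof (rule emeasure_measure_of[OF compound_poisson_def])
  let ?f = "\<lambda>A. \<Sum>m. ennreal (exp (- measure Q UNIV) / fact m) * emeasure (conv_power Q m) A"
  show "positive (sets (compound_poisson Q)) ?f" by (simp add: positive_def)
  show "countably_additive (sets (compound_poisson Q)) ?f"
  proof (rule countably_additiveI)
    fix A :: "nat \<Rightarrow> real set" assume A: "range A \<subseteq> sets (compound_poisson Q)" "disjoint_family A"
    have sw: "(\<Sum>i. ennreal (exp (- measure Q UNIV) / fact m) * emeasure (conv_power Q m) (A i)) =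
        ennreal (exp (- measure Q UNIV) / fact m) * emeasure (conv_power Q m) (\<Union>i. A i)" for m
      using A by (subst ennreal_suminf_cmult, subst suminf_emeasure) (auto simp: sets_conv_power)
    have "(\<Sum>i. ?f (A i)) = (\<Sum>i. \<integral>\<^sup>+m. ennreal (exp (- measure Q UNIV) / fact m) * emeasure (conv_power Q m) (A i) \<partial>count_space UNIV)"
      by (simp add: nn_integral_count_space_nat)
    also have "\<dots> = (\<integral>\<^sup>+m. (\<Sum>i. ennreal (exp (- measure Q UNIV) / fact m) * emeasure (conv_power Q m) (A i)) \<partial>count_space UNIV)"
      by (rule nn_integral_suminf[symmetric]) auto
    also have "\<dots> = ?f (\<Union>i. A i)" unfolding sw by (simp add: nn_integral_count_space_nat)
    finally show "(\<Sum>i. ?f (A i)) = ?f (\<Union>i. A i)" .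
  qed
qed (use assms in auto)

text \<open>Sums over the number of jumps are treated as integrals over the counting measure on the naturals,
  which lets monotone convergence exchange them with suprema.\<close>

lemma nn_integral_compound_poisson:
  assumes "f \<in> borel_measurable borel"
  shows "(\<integral>\<^sup>+x. f x \<partial>(compound_poisson Q)) =
    (\<Sum>m. ennreal (exp (- measure Q UNIV) / fact m) * (\<integral>\<^sup>+x. f x \<partial>conv_power Q m))"
  using assms
proof (induction rule: borel_measurable_induct)
  case (cong f g)
  then have "f = g" by auto
  then show ?case using cong by simp
next
  case (set A)
  then show ?case by (simp add: emeasure_compound_poisson sets_conv_power)
next
  case (mult u c)
  then show ?case
    by (simp add: nn_integral_cmult measurable_cong_sets[OF sets_conv_power refl] mult.left_commute
      flip: ennreal_suminf_cmult)
next
  case (add u v)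
  then show ?case
    by (simp add: nn_integral_add measurable_cong_sets[OF sets_conv_power refl] ring_distribs suminf_add)
next
  case (seq U)
  have "(\<integral>\<^sup>+x. (SUP i. U i) x \<partial>(compound_poisson Q)) = (SUP i. \<integral>\<^sup>+x. U i x \<partial>(compound_poisson Q))"
    using seq by (simp add: image_image nn_integral_monotone_convergence_SUP)
  also have "\<dots> = (SUP i. \<integral>\<^sup>+m. ennreal (exp (- measure Q UNIV) / fact m) * (\<integral>\<^sup>+x. U i x \<partial>conv_power Q m) \<partial>count_space UNIV)"
    using seq by (simp add: nn_integral_count_space_nat)
  also have "\<dots> = (\<integral>\<^sup>+m. (SUP i. ennreal (exp (- measure Q UNIV) / fact m) * (\<integral>\<^sup>+x. U i x \<partial>conv_power Q m)) \<partial>count_space UNIV)"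
    using seq by (intro nn_integral_monotone_convergence_SUP[symmetric])
      (auto simp: incseq_def le_fun_def intro!: mult_left_mono nn_integral_mono)
  also have "\<dots> = (\<integral>\<^sup>+m. ennreal (exp (- measure Q UNIV) / fact m) * (\<integral>\<^sup>+x. (SUP i. U i) x \<partial>conv_power Q m) \<partial>count_space UNIV)"
    using seq by (intro nn_integral_cong)
      (simp add: SUP_mult_left_ennreal[symmetric] nn_integral_monotone_convergence_SUP measurable_cong_sets[OF sets_conv_power refl] image_image)
  finally show ?case by (simp add: nn_integral_count_space_nat)
qed

lemma prob_space_compound_poisson: "prob_space (compound_poisson Q)"
proof (rule prob_spaceI)
  have "emeasure (compound_poisson Q) UNIV = (\<Sum>m. ennreal (exp (- measure Q UNIV) / fact m * measure Q UNIV ^ m))"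
    by (simp add: emeasure_compound_poisson emeasure_conv_power_UNIV ennreal_mult[symmetric])
  also have "(\<lambda>m. exp (- measure Q UNIV) / fact m * measure Q UNIV ^ m) sums (exp (- measure Q UNIV) * exp (measure Q UNIV))"
    using sums_mult[OF exp_converges[of "measure Q UNIV"], of "exp (- measure Q UNIV)"] by (simp add: field_simps)
  then have "(\<Sum>m. ennreal (exp (- measure Q UNIV) / fact m * measure Q UNIV ^ m)) = 1"
    by (subst suminf_ennreal_eq) (auto simp: mult_exp_exp)
  finally show "emeasure (compound_poisson Q) (space (compound_poisson Q)) = 1" by simp
qed

lemma real_distribution_compound_poisson: "real_distribution (compound_poisson Q)"
  using prob_space_compound_poisson
  by (simp add: real_distribution_def real_distribution_axioms_def)

text \<open>The case of nonnegative integrands follows from the nonnegative integral. A bounded integrand is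
  made nonnegative by adding its bound \<open>K\<close>.\<close>

lemma integral_compound_poisson:
  fixes f :: "real \<Rightarrow> real"
  assumes [measurable]: "f \<in> borel_measurable borel" and bd: "\<And>x. \<bar>f x\<bar> \<le> K"
  shows "(\<lambda>m. exp (- measure Q UNIV) / fact m * (LINT x|conv_power Q m. f x)) sums (LINT x|(compound_poisson Q). f x)"
proof -
  let ?c = "\<lambda>m. exp (- measure Q UNIV) / fact m"
  interpret P: prob_space "compound_poisson Q" by (rule prob_space_compound_poisson)
  interpret C: finite_measure "conv_power Q m" for m by (rule finite_conv_power)
  have main: "(\<lambda>m. ?c m * (LINT x|conv_power Q m. g x)) sums (LINT x|(compound_poisson Q). g x)"
    if g[measurable]: "g \<in> borel_measurable borel" and g0: "\<And>x. 0 \<le> g x" and gK: "\<And>x. g x \<le> B" for g :: "real \<Rightarrow> real" and B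
  proof -
    have "ennreal (LINT x|(compound_poisson Q). g x) = (\<integral>\<^sup>+x. g x \<partial>(compound_poisson Q))"
      using g0 gK by (intro nn_integral_eq_integral[symmetric] P.integrable_const_bound[where B=B]) auto
    also have "\<dots> = (\<Sum>m. ennreal (?c m) * (\<integral>\<^sup>+x. g x \<partial>conv_power Q m))"
      by (rule nn_integral_compound_poisson) measurable
    also have "\<dots> = (\<Sum>m. ennreal (?c m * (LINT x|conv_power Q m. g x)))"
      using g0 gK
      by (intro suminf_cong, subst nn_integral_eq_integral)
         (auto simp: ennreal_mult[symmetric] measurable_cong_sets[OF sets_conv_power refl] intro!: C.integrable_const_bound[where B=B])
    finally have eq: "(\<Sum>m. ennreal (?c m * (LINT x|conv_power Q m. g x))) = ennreal (LINT x|(compound_poisson Q). g x)" by simp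
    have nn: "0 \<le> ?c m * (LINT x|conv_power Q m. g x)" for m using g0 by auto
    have s: "summable (\<lambda>m. ?c m * (LINT x|conv_power Q m. g x))"
      using nn eq by (intro summable_suminf_not_top) auto
    have "(\<Sum>m. ?c m * (LINT x|conv_power Q m. g x)) = (LINT x|(compound_poisson Q). g x)"
      using eq nn g0 suminf_nonneg[OF s nn] by (subst (asm) suminf_ennreal2[OF nn s]) (auto simp: ennreal_inj)
    then show ?thesis using s by (simp add: sums_iff)
  qed
  have K0: "K \<ge> 0" using bd[of 0] by linarith
  have "(\<lambda>m. ?c m * (LINT x|conv_power Q m. f x + K)) sums (LINT x|(compound_poisson Q). f x + K)"
    by (rule main[of "\<lambda>x. f x + K" "2 * K"]) (use bd in \<open>auto simp: abs_le_iff, smt+\<close>)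
  from sums_diff[OF this main[of "\<lambda>_. K" K]]
  have "(\<lambda>m. ?c m * ((LINT x|conv_power Q m. f x + K) - (LINT x|conv_power Q m. K))) sums
     ((LINT x|(compound_poisson Q). f x + K) - (LINT x|(compound_poisson Q). K))"
    using K0 by (simp add: right_diff_distrib)
  moreover have "integrable (conv_power Q m) f" for m
    using bd by (intro C.integrable_const_bound[where B=K]) (auto simp: measurable_cong_sets[OF sets_conv_power refl])
  moreover have "integrable (compound_poisson Q) f"
    using bd by (intro P.integrable_const_bound[where B=K]) auto
  ultimately show ?thesis by (simp add: Bochner_Integration.integral_add)
qed

lemma char_compound_poisson:
  "char (compound_poisson Q) \<xi> = exp (char Q \<xi> - measure Q UNIV)"
proof -
  let ?c = "\<lambda>m. exp (- measure Q UNIV) / fact m"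
  interpret P: prob_space "compound_poisson Q" by (rule prob_space_compound_poisson)
  interpret C: finite_measure "conv_power Q m" for m by (rule finite_conv_power)
  have of_real_mult_Re: "Re (complex_of_real r * z) = r * Re z" and of_real_mult_Im: "Im (complex_of_real r * z) = r * Im z"
    for r z by simp_all
  have I: "integrable (conv_power Q m) (\<lambda>x. iexp (\<xi> * x))" for m
    by (intro C.integrable_const_bound[where B=1]) (auto simp: measurable_cong_sets[OF sets_conv_power refl])
  have I': "integrable (compound_poisson Q) (\<lambda>x. iexp (\<xi> * x))"
    by (intro P.integrable_const_bound[where B=1]) auto
  have "(\<lambda>m. complex_of_real (?c m) * char (conv_power Q m) \<xi>) sums char (compound_poisson Q) \<xi>"
    unfolding sums_complex_iff
  proof
    have "Re (char (conv_power Q m) \<xi>) = (LINT x|conv_power Q m. cos (\<xi> * x))" for m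
      unfolding char_def by (subst integral_Re[OF I, symmetric]) (simp add: Re_exp)
    then have "Re (complex_of_real (?c m) * char (conv_power Q m) \<xi>) = ?c m * (LINT x|conv_power Q m. cos (\<xi> * x))" for m
      by (simp only: of_real_mult_Re)
    moreover have "Re (char (compound_poisson Q) \<xi>) = (LINT x|(compound_poisson Q). cos (\<xi> * x))"
      unfolding char_def by (subst integral_Re[OF I', symmetric]) (simp add: Re_exp)
    ultimately show "(\<lambda>m. Re (complex_of_real (?c m) * char (conv_power Q m) \<xi>)) sums Re (char (compound_poisson Q) \<xi>)"
      using integral_compound_poisson[of "\<lambda>x. cos (\<xi> * x)" 1] by simp
    have "Im (char (conv_power Q m) \<xi>) = (LINT x|conv_power Q m. sin (\<xi> * x))" for m
      unfolding char_def by (subst integral_Im[OF I, symmetric]) (simp add: Im_exp)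
    then have "Im (complex_of_real (?c m) * char (conv_power Q m) \<xi>) = ?c m * (LINT x|conv_power Q m. sin (\<xi> * x))" for m
      by (simp only: of_real_mult_Im)
    moreover have "Im (char (compound_poisson Q) \<xi>) = (LINT x|(compound_poisson Q). sin (\<xi> * x))"
      unfolding char_def by (subst integral_Im[OF I', symmetric]) (simp add: Im_exp)
    ultimately show "(\<lambda>m. Im (complex_of_real (?c m) * char (conv_power Q m) \<xi>)) sums Im (char (compound_poisson Q) \<xi>)"
      using integral_compound_poisson[of "\<lambda>x. sin (\<xi> * x)" 1] by simp
  qed
  moreover have "(\<lambda>m. complex_of_real (?c m) * char (conv_power Q m) \<xi>) sums (complex_of_real (exp (- measure Q UNIV)) * exp (char Q \<xi>))"
    using sums_mult[OF exp_converges[of "char Q \<xi>"], of "complex_of_real (exp (- measure Q UNIV))"]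
    by (simp add: char_conv_power scaleR_conv_of_real field_simps)
  ultimately have "char (compound_poisson Q) \<xi> = complex_of_real (exp (- measure Q UNIV)) * exp (char Q \<xi>)"
    by (rule sums_unique2)
  then show ?thesis by (simp add: exp_diff exp_minus exp_of_real field_simps)
qed

lemma nn_integral_exp_compound_poisson:
  assumes "(\<integral>\<^sup>+x. ennreal (exp (s * x)) \<partial>Q) = ennreal e" "e \<ge> 0"
  shows "(\<integral>\<^sup>+x. ennreal (exp (s * x)) \<partial>(compound_poisson Q)) = ennreal (exp (e - measure Q UNIV))"
proof -
  have "(\<integral>\<^sup>+x. ennreal (exp (s * x)) \<partial>(compound_poisson Q)) = (\<Sum>m. ennreal (exp (- measure Q UNIV) / fact m * e ^ m))"
    using assms by (subst nn_integral_compound_poisson) (auto simp: nn_integral_exp_conv_power ennreal_power ennreal_mult[symmetric])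
  also have "(\<lambda>m. exp (- measure Q UNIV) / fact m * e ^ m) sums (exp (- measure Q UNIV) * exp e)"
    using sums_mult[OF exp_converges[of e], of "exp (- measure Q UNIV)"] by (simp add: field_simps)
  then have "(\<Sum>m. ennreal (exp (- measure Q UNIV) / fact m * e ^ m)) = ennreal (exp (- measure Q UNIV) * exp e)"
    using assms by (subst suminf_ennreal_eq) auto
  finally show ?thesis by (simp add: mult_exp_exp add.commute)
qed

end

section \<open>Infinitely divisible laws with bounded jumps\<close>

lemma exp_le_quadratic:
  fixes v :: real assumes "\<bar>v\<bar> \<le> 1" shows "exp v \<le> 1 + v + v\<^sup>2"
proof (cases "v \<ge> 0")
  case False
  define w where "w = - v"
  have w: "w > 0" using False by (simp add: w_def)
  have "exp v = 1 / exp w" by (simp add: w_def exp_minus field_simps)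
  also have "\<dots> \<le> 1 / (1 + w)" using w exp_ge_add_one_self[of w] by (intro divide_left_mono) auto
  also have "\<dots> \<le> 1 - w + w\<^sup>2"
  proof -
    have "1 \<le> (1 - w + w\<^sup>2) * (1 + w)" using w by (simp add: algebra_simps power2_eq_square)
    then show ?thesis using w by (simp add: divide_le_eq)
  qed
  finally show ?thesis by (simp add: w_def)
qed (use assms in \<open>auto intro: exp_bound\<close>)

lemma norm_compensated_iexp_le: "cmod (1 - iexp v + \<i> * v) \<le> v\<^sup>2 / 2"
proof -
  have "cmod (iexp v - (1 + \<i> * v)) \<le> v\<^sup>2 / 2"
    using iexp_approx1[of v 1] by (simp add: eval_nat_numeral)
  then show ?thesis by (simp add: norm_minus_commute diff_add_eq algebra_simps)
qed

text \<open>Markov's inequality for \<open>exp (r * x) + exp (- r * x)\<close>.\<close>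

lemma two_sided_tail_bound:
  assumes N: "real_distribution N" and r: "r > 0"
    and mom: "(\<integral>\<^sup>+x. exp (r * x) \<partial>N) \<le> ennreal E" "(\<integral>\<^sup>+x. exp (- r * x) \<partial>N) \<le> ennreal E" and E: "E \<ge> 0"
  shows "measure N {-b<..b} \<ge> 1 - 2 * E * exp (- (r * b))"
proof -
  interpret N: real_distribution N by (rule N)
      have "emeasure (N) (UNIV - {-b<..b}) = (\<integral>\<^sup>+x. indicator (UNIV - {-b<..b}) x \<partial>N)"
        by (subst nn_integral_indicator) auto
      also have "\<dots> \<le> (\<integral>\<^sup>+x. ennreal (exp (- (r * b))) * (ennreal (exp (r * x)) + ennreal (exp (- r * x))) \<partial>N)"
      proof (rule nn_integral_mono)
        fix x
        have "1 \<le> exp (- (r * b)) * (exp (r * x) + exp (- r * x))" if "x \<le> -b \<or> x > b"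
        proof -
          have "exp (r * b) \<le> exp (r * x) + exp (- r * x)"
          proof (cases "x > b")
            case True
            then have "exp (r * b) \<le> exp (r * x)" using r by simp
            then show ?thesis using exp_gt_zero[of "-r * x"] by linarith
          next
            case False
            then have "r * b \<le> r * (- x)" using that r by (intro mult_left_mono) auto
            then have "exp (r * b) \<le> exp (- r * x)" by simp
            then show ?thesis using exp_gt_zero[of "r * x"] by linarith
          qed
          then show ?thesis by (simp add: exp_minus field_simps)
        qed
        then show "indicator (UNIV - {-b<..b}) x \<le> ennreal (exp (- (r * b))) * (ennreal (exp (r * x)) + ennreal (exp (- r * x)))"
          by (auto split: split_indicator simp flip: ennreal_plus ennreal_mult)
      qed
      also have "\<dots> = ennreal (exp (- (r * b))) * ((\<integral>\<^sup>+x. exp (r * x) \<partial>N) + (\<integral>\<^sup>+x. exp (- r * x) \<partial>N))"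
        by (subst nn_integral_cmult, simp, subst nn_integral_add) auto
      also have "\<dots> \<le> ennreal (exp (- (r * b))) * (ennreal E + ennreal E)"
        by (intro mult_left_mono add_mono mom) auto
      also have "\<dots> = ennreal (2 * E * exp (- (r * b)))"
        using E by (simp flip: ennreal_plus ennreal_mult)
      finally have "measure N (UNIV - {-b<..b}) \<le> 2 * E * exp (- (r * b))"
        using E by (simp add: N.emeasure_eq_measure)
      moreover have "measure N (UNIV - {-b<..b}) = 1 - measure N {-b<..b}"
        using N.prob_compl[of "{-b<..b}"] by simp
      ultimately show ?thesis by simp
qed

text \<open>The pointwise limit \<open>\<phi>\<close> is not assumed to be a characteristic function. Uniform exponential moments give
  tightness, Helly's theorem gives a limit along a subsequence, and the convergence of characteristic
  functions identifies it. The moments pass to the limit by testing against the bounded continuous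
  functions \<open>min (exp (c * x)) k\<close>.\<close>

lemma limit_law_if_exp_moments:
  fixes N :: "nat \<Rightarrow> real measure"
  assumes N: "\<And>n. real_distribution (N n)" and r: "r > 0"
    and mom: "\<And>n. (\<integral>\<^sup>+x. exp (r * x) \<partial>N n) \<le> ennreal E" "\<And>n. (\<integral>\<^sup>+x. exp (- r * x) \<partial>N n) \<le> ennreal E"
    and lim: "\<And>\<xi>. (\<lambda>n. char (N n) \<xi>) \<longlonglongrightarrow> \<phi> \<xi>"
  obtains L where "real_distribution L" "\<And>\<xi>. char L \<xi> = \<phi> \<xi>"
    "(\<integral>\<^sup>+x. exp (r * x) \<partial>L) \<le> ennreal E" "(\<integral>\<^sup>+x. exp (- r * x) \<partial>L) \<le> ennreal E"
proof -
  interpret N: real_distribution "N n" for n by (rule N)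
  have E: "E > 0"
  proof (rule ccontr)
    assume "\<not> E > 0"
    then have "(\<integral>\<^sup>+x. exp (r * x) \<partial>N 0) = 0" using mom(1)[of 0] by (simp add: ennreal_neg)
    then have "AE x in N 0. ennreal (exp (r * x)) = 0" by (subst (asm) nn_integral_0_iff_AE) auto
    then have "AE x in N 0. False" by eventually_elim auto
    then show False using N.AE_False by auto
  qed
  have tight: "tight N"
    unfolding tight_def
  proof (intro conjI allI impI N)
    fix \<epsilon> :: real assume e: "\<epsilon> > 0"
    have "((\<lambda>b. 2 * E * exp (- (r * b))) \<longlongrightarrow> 2 * E * 0) at_top"
      using r by (intro tendsto_mult tendsto_const filterlim_compose[OF exp_at_bot])
        (auto simp: filterlim_uminus_at_bot intro!: filterlim_tendsto_pos_mult_at_top[OF tendsto_const _ filterlim_ident])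
    then have "eventually (\<lambda>b. 2 * E * exp (- (r * b)) < \<epsilon> \<and> b > 0) at_top"
      using e by (intro eventually_conj eventually_gt_at_top order_tendstoD(2)) auto
    then obtain b where b: "2 * E * exp (- (r * b)) < \<epsilon>" "b > 0"
      unfolding eventually_at_top_linorder by blast
    have "measure (N n) {-b<..b} > 1 - \<epsilon>" for n
      using two_sided_tail_bound[OF N r mom(1)[of n] mom(2)[of n] less_imp_le[OF E], of b] b by simp
    then show "\<exists>a b. a < b \<and> (\<forall>n. measure (N n) {a<..b} > 1 - \<epsilon>)"
      using b by (intro exI[of _ "-b"] exI[of _ b]) auto
  qed
  from tight_imp_convergent_subsubsequence[OF this, of id]
  obtain s L where s: "strict_mono s" and L: "real_distribution L" and "weak_conv_m (N \<circ> id \<circ> s) L"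
    by (auto simp: strict_mono_def)
  then have w: "weak_conv_m (\<lambda>n. N (s n)) L" by (simp add: comp_def)
  interpret L: real_distribution L by (rule L)
  have charL: "char L \<xi> = \<phi> \<xi>" for \<xi>
  proof (rule LIMSEQ_unique)
    show "(\<lambda>n. char (N (s n)) \<xi>) \<longlonglongrightarrow> char L \<xi>" by (rule levy_continuity1[OF N L w])
    show "(\<lambda>n. char (N (s n)) \<xi>) \<longlonglongrightarrow> \<phi> \<xi>" using LIMSEQ_subseq_LIMSEQ[OF lim s] by (simp add: comp_def)
  qed
  have momL: "(\<integral>\<^sup>+x. exp (c * x) \<partial>L) \<le> ennreal E" if c: "\<And>n. (\<integral>\<^sup>+x. exp (c * x) \<partial>N n) \<le> ennreal E" for c
  proof -
    let ?g = "\<lambda>k::nat. \<lambda>x. min (exp (c * x)) (real k)"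
    have "(\<integral>\<^sup>+x. exp (c * x) \<partial>L) = (\<integral>\<^sup>+x. (SUP k. ennreal (?g k x)) \<partial>L)"
    proof (rule nn_integral_cong)
      fix x
      show "ennreal (exp (c * x)) = (SUP k. ennreal (?g k x))"
      proof (rule antisym)
        obtain k where k: "exp (c * x) \<le> real k" using real_arch_simple by blast
        then have "ennreal (exp (c * x)) = ennreal (?g k x)" by (simp add: min_def)
        then show "ennreal (exp (c * x)) \<le> (SUP k. ennreal (?g k x))" by (metis SUP_upper UNIV_I)
      qed (auto intro!: SUP_least ennreal_leI)
    qed
    also have "\<dots> = (SUP k. \<integral>\<^sup>+x. ennreal (?g k x) \<partial>L)"
      by (rule nn_integral_monotone_convergence_SUP) (auto simp: incseq_def le_fun_def intro!: ennreal_leI)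
    also have "\<dots> \<le> ennreal E"
    proof (rule SUP_least)
      fix k
      have b: "\<bar>?g k x\<bar> \<le> real k" for x by auto
      have "(LINT x|N (s n). ?g k x) \<le> E" for n
      proof -
        have "ennreal (LINT x|N (s n). ?g k x) = (\<integral>\<^sup>+x. ennreal (?g k x) \<partial>N (s n))"
          by (intro nn_integral_eq_integral[symmetric] N.integrable_const_bound[where B="real k"]) (use b in auto)
        also have "\<dots> \<le> (\<integral>\<^sup>+x. exp (c * x) \<partial>N (s n))" by (intro nn_integral_mono ennreal_leI) auto
        also have "\<dots> \<le> ennreal E" by (rule c)
        finally show ?thesis using E by simp
      qed
      moreover have "(\<lambda>n. LINT x|N (s n). ?g k x) \<longlonglongrightarrow> (LINT x|L. ?g k x)"
        by (rule weak_conv_imp_integral_bdd_continuous_conv[OF N L w, where B="real k"])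
          (use b in \<open>auto intro!: continuous_intros\<close>)
      ultimately have "(LINT x|L. ?g k x) \<le> E" by (intro LIMSEQ_le_const2) auto
      moreover have "ennreal (LINT x|L. ?g k x) = (\<integral>\<^sup>+x. ennreal (?g k x) \<partial>L)"
        by (intro nn_integral_eq_integral[symmetric] L.integrable_const_bound[where B="real k"]) (use b in auto)
      ultimately show "(\<integral>\<^sup>+x. ennreal (?g k x) \<partial>L) \<le> ennreal E" by (metis ennreal_leI)
    qed
    finally show ?thesis .
  qed
  show ?thesis using that[OF L charL momL momL] mom by auto
qed

text \<open>The part of the Levy-Khintchine theorem that is needed: jumps in \<open>[- 1 / r, 1 / r]\<close> with a finite second
  moment. Removing the jumps of size at most \<open>1 / (n + 1)\<close> leaves a finite measure, whose centred compound
  Poisson law has the right exponent; its exponential moments are bounded by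
  \<open>exp v - 1 - v \<le> v\<^sup>2\<close> for \<open>\<bar>v\<bar> \<le> 1\<close>, uniformly in \<open>n\<close>. Then \<open>n\<close> tends to infinity.\<close>

lemma compensated_law_exists:
  fixes \<nu> :: "real measure"
  assumes sets[measurable_cong]: "sets \<nu> = sets borel" and r: "r > 0" and supp: "AE u in \<nu>. \<bar>r * u\<bar> \<le> 1"
    and int: "integrable \<nu> (\<lambda>u. (r * u)\<^sup>2)"
  obtains N where "real_distribution N" "\<And>\<xi>. char N \<xi> = exp (- (CLINT u|\<nu>. 1 - iexp (\<xi> * u) + \<i> * \<xi> * u))"
    "(\<integral>\<^sup>+x. exp (r * x) \<partial>N) \<le> ennreal (exp (LINT u|\<nu>. (r * u)\<^sup>2))"
    "(\<integral>\<^sup>+x. exp (- r * x) \<partial>N) \<le> ennreal (exp (LINT u|\<nu>. (r * u)\<^sup>2))"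
proof -
  define A where "A n = {u::real. 1 / Suc n < \<bar>u\<bar>}" for n
  have [measurable]: "A n \<in> sets borel" for n unfolding A_def by measurable
  define V where "V n = density \<nu> (\<lambda>u. ennreal (indicator (A n) u))" for n
  have setsV[measurable_cong]: "sets (V n) = sets borel" for n by (simp add: V_def sets)
  have spaceV: "space (V n) = UNIV" for n using setsV[of n, THEN sets_eq_imp_space_eq] by simp
  have int2: "integrable \<nu> (\<lambda>u. u\<^sup>2)"
    using int r by (simp add: power_mult_distrib)
  have finV: "finite_measure (V n)" for n
  proof (rule finite_measureI)
    have "emeasure (V n) (space (V n)) = (\<integral>\<^sup>+u. ennreal (indicator (A n) u) \<partial>\<nu>)"
      by (simp add: V_def emeasure_density space_density cong: nn_integral_cong)
    also have "\<dots> \<le> (\<integral>\<^sup>+u. ennreal ((real (Suc n))\<^sup>2 * u\<^sup>2) \<partial>\<nu>)"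
    proof (intro nn_integral_mono ennreal_leI)
      fix u :: real
      have "1 \<le> (real (Suc n))\<^sup>2 * u\<^sup>2" if "u \<in> A n"
      proof -
        have "1 \<le> real (Suc n) * \<bar>u\<bar>" using that by (simp add: A_def field_simps)
        then have "1\<^sup>2 \<le> (real (Suc n) * \<bar>u\<bar>)\<^sup>2" by (rule power_mono) auto
        then show ?thesis by (simp add: power_mult_distrib)
      qed
      then show "indicator (A n) u \<le> (real (Suc n))\<^sup>2 * u\<^sup>2" by (auto split: split_indicator)
    qed
    also have "\<dots> = ennreal (LINT u|\<nu>. (real (Suc n))\<^sup>2 * u\<^sup>2)"
      using int2 by (intro nn_integral_eq_integral) auto
    finally show "emeasure (V n) (space (V n)) \<noteq> \<infinity>" by (auto simp: top_unique)
  qed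
  interpret V: finite_measure "V n" for n by (rule finV)
  interpret CP: prob_space "compound_poisson (V n)" for n by (rule prob_space_compound_poisson[OF finV setsV])
  note [measurable_cong] = sets_compound_poisson[OF finV setsV]
  have suppV: "AE u in V n. \<bar>r * u\<bar> \<le> 1" for n
    unfolding V_def using supp by (subst AE_density) auto
  have intV: "integrable (V n) (\<lambda>u. u)" "integrable (V n) (\<lambda>u. exp (s * u))" if "\<bar>s\<bar> \<le> r" for n s
  proof -
    show "integrable (V n) (\<lambda>u. u)"
      using suppV[of n] by (intro V.integrable_const_bound[where B="1/r"]) (use r in \<open>auto simp: abs_mult field_simps elim!: eventually_mono\<close>)
    show "integrable (V n) (\<lambda>u. exp (s * u))"
    proof (rule V.integrable_const_bound[where B="exp 1"])
      show "AE u in V n. norm (exp (s * u)) \<le> exp 1"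
        using suppV[of n]
      proof eventually_elim
        case (elim u)
        have "s * u \<le> \<bar>s\<bar> * \<bar>u\<bar>" by (metis abs_ge_self abs_mult)
        also have "\<dots> \<le> r * \<bar>u\<bar>" using that by (intro mult_right_mono) auto
        also have "\<dots> \<le> 1" using elim r by (simp add: abs_mult)
        finally show ?case by simp
      qed
    qed auto
  qed
  define m where "m n = (LINT u|V n. u)" for n
  define N where "N n = distr (compound_poisson (V n)) borel (\<lambda>x. x - m n)" for n
  have realN: "real_distribution (N n)" for n
    unfolding N_def by (auto simp: real_distribution_def real_distribution_axioms_def intro!: CP.prob_space_distr)
  have intg: "integrable \<nu> (\<lambda>u. 1 - iexp (\<xi> * u) + \<i> * \<xi> * u)" for \<xi>
  proof (rule Bochner_Integration.integrable_bound)
    show "integrable \<nu> (\<lambda>u. \<xi>\<^sup>2 / 2 * u\<^sup>2)" using int2 by auto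
    show "AE u in \<nu>. norm (1 - iexp (\<xi> * u) + \<i> * \<xi> * u) \<le> norm (\<xi>\<^sup>2 / 2 * u\<^sup>2)"
      using norm_compensated_iexp_le[of "\<xi> * u" for u] by (intro AE_I2) (auto simp: power_mult_distrib mult.assoc)
  qed simp
  have charN: "char (N n) \<xi> = exp (- (CLINT u|\<nu>. indicator (A n) u *\<^sub>R (1 - iexp (\<xi> * u) + \<i> * \<xi> * u)))" for n \<xi>
  proof -
    have "char (N n) \<xi> = (CLINT x|compound_poisson (V n). iexp (\<xi> * (x - m n)))"
      unfolding char_def N_def by (subst integral_distr) auto
    also have "\<dots> = (CLINT x|compound_poisson (V n). iexp (- (\<xi> * m n)) * iexp (\<xi> * x))"
      by (simp add: mult_exp_exp algebra_simps)
    also have "\<dots> = iexp (- (\<xi> * m n)) * exp (char (V n) \<xi> - measure (V n) UNIV)"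
      using char_compound_poisson[OF finV setsV, of n \<xi>] unfolding char_def by simp
    also have "\<dots> = exp (- (CLINT u|V n. 1 - iexp (\<xi> * u) + \<i> * \<xi> * u))"
    proof -
      have i1: "integrable (V n) (\<lambda>u. iexp (\<xi> * u))" by (rule V.integrable_const_bound[where B=1]) auto
      have i2: "integrable (V n) (\<lambda>u. complex_of_real u)" using intV(1)[of 0 n] r by simp
      have "(CLINT u|V n. 1 - iexp (\<xi> * u) + \<i> * \<xi> * u) = measure (V n) UNIV - char (V n) \<xi> + \<i> * \<xi> * m n"
        unfolding char_def m_def using i1 i2
        by (subst Bochner_Integration.integral_add) (auto simp: spaceV scaleR_conv_of_real intro!: Bochner_Integration.integrable_diff Bochner_Integration.integrable_mult_right)
      then show ?thesis by (simp only: mult_exp_exp) (simp add: algebra_simps)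
    qed
    also have "(CLINT u|V n. 1 - iexp (\<xi> * u) + \<i> * \<xi> * u) = (CLINT u|\<nu>. indicator (A n) u *\<^sub>R (1 - iexp (\<xi> * u) + \<i> * \<xi> * u))"
      unfolding V_def by (subst integral_density) auto
    finally show ?thesis .
  qed
  have momN: "(\<integral>\<^sup>+x. exp (s * x) \<partial>N n) \<le> ennreal (exp (LINT u|\<nu>. (r * u)\<^sup>2))" if s: "\<bar>s\<bar> = r" for n s
  proof -
    define e where "e = (LINT u|V n. exp (s * u))"
    have e: "(\<integral>\<^sup>+u. exp (s * u) \<partial>V n) = ennreal e" "e \<ge> 0"
      using intV(2)[of s n] s by (auto simp: e_def nn_integral_eq_integral intro!: integral_nonneg)
    have "(\<integral>\<^sup>+x. exp (s * x) \<partial>N n) = (\<integral>\<^sup>+x. ennreal (exp (- (s * m n))) * ennreal (exp (s * x)) \<partial>compound_poisson (V n))"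
      unfolding N_def by (subst nn_integral_distr) (auto simp: mult_exp_exp algebra_simps simp flip: ennreal_mult)
    also have "\<dots> = ennreal (exp (- (s * m n))) * ennreal (exp (e - measure (V n) UNIV))"
      using nn_integral_exp_compound_poisson[OF finV setsV e] by (subst nn_integral_cmult) auto
    also have "\<dots> = ennreal (exp (LINT u|V n. exp (s * u) - 1 - s * u))"
      using intV[of s n] s
      by (simp add: e_def m_def mult_exp_exp spaceV algebra_simps flip: ennreal_mult)
    also have "\<dots> \<le> ennreal (exp (LINT u|\<nu>. (r * u)\<^sup>2))"
    proof -
      have "(LINT u|V n. exp (s * u) - 1 - s * u) = (LINT u|\<nu>. indicator (A n) u * (exp (s * u) - 1 - s * u))"
        unfolding V_def by (subst integral_density) auto
      also have "\<dots> \<le> (LINT u|\<nu>. (r * u)\<^sup>2)"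
      proof (rule integral_mono_AE'[OF int])
        show "AE u in \<nu>. indicator (A n) u * (exp (s * u) - 1 - s * u) \<le> (r * u)\<^sup>2"
          using supp
        proof eventually_elim
          case (elim u)
          then have "\<bar>s * u\<bar> \<le> 1" using s r by (simp add: abs_mult)
          from exp_le_quadratic[OF this] have "exp (s * u) - 1 - s * u \<le> (s * u)\<^sup>2" by simp
          also have "(s * u)\<^sup>2 = (r * u)\<^sup>2" using s r by (metis power2_abs power_mult_distrib)
          finally show ?case by (auto split: split_indicator)
        qed
      qed simp
      finally show ?thesis by (intro ennreal_leI) simp
    qed
    finally show ?thesis .
  qed
  have lim: "(\<lambda>n. char (N n) \<xi>) \<longlonglongrightarrow> exp (- (CLINT u|\<nu>. 1 - iexp (\<xi> * u) + \<i> * \<xi> * u))" for \<xi>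
    unfolding charN
  proof (intro tendsto_intros integral_dominated_convergence[where w="\<lambda>u. norm (1 - iexp (\<xi> * u) + \<i> * \<xi> * u)"])
    show "AE u in \<nu>. (\<lambda>n. indicator (A n) u *\<^sub>R (1 - iexp (\<xi> * u) + \<i> * \<xi> * u)) \<longlonglongrightarrow> 1 - iexp (\<xi> * u) + \<i> * \<xi> * u"
    proof (rule AE_I2)
      fix u :: real
      have "eventually (\<lambda>n. 1 - iexp (\<xi> * u) + \<i> * \<xi> * u = indicator (A n) u *\<^sub>R (1 - iexp (\<xi> * u) + \<i> * \<xi> * u)) sequentially"
      proof (cases "u = 0")
        case False
        then have "eventually (\<lambda>n. 1 / real (Suc n) < \<bar>u\<bar>) sequentially"
          by (intro order_tendstoD(2)[OF LIMSEQ_Suc[OF lim_1_over_n]]) auto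
        then show ?thesis by eventually_elim (simp add: A_def)
      qed simp
      then show "(\<lambda>n. indicator (A n) u *\<^sub>R (1 - iexp (\<xi> * u) + \<i> * \<xi> * u)) \<longlonglongrightarrow> 1 - iexp (\<xi> * u) + \<i> * \<xi> * u"
        by (rule Lim_transform_eventually[OF tendsto_const])
    qed
    show "integrable \<nu> (\<lambda>u. norm (1 - iexp (\<xi> * u) + \<i> * \<xi> * u))" using intg by auto
    show "AE u in \<nu>. norm (indicator (A n) u *\<^sub>R (1 - iexp (\<xi> * u) + \<i> * \<xi> * u)) \<le> norm (1 - iexp (\<xi> * u) + \<i> * \<xi> * u)" for n
      by (rule AE_I2) (simp add: indicator_def)
  qed simp_all
  have "\<bar>r\<bar> = r" "\<bar>- r\<bar> = r" using r by auto
  note eq = this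
  show ?thesis
  proof (rule limit_law_if_exp_moments[OF realN r momN[OF eq(1)] momN[OF eq(2)] lim])
    fix L
    assume L: "real_distribution L" "\<And>\<xi>. char L \<xi> = exp (- (CLINT u|\<nu>. 1 - iexp (\<xi> * u) + \<i> * \<xi> * u))"
      "(\<integral>\<^sup>+x. exp (r * x) \<partial>L) \<le> ennreal (exp (LINT u|\<nu>. (r * u)\<^sup>2))"
      "(\<integral>\<^sup>+x. exp (- r * x) \<partial>L) \<le> ennreal (exp (LINT u|\<nu>. (r * u)\<^sup>2))"
    show ?thesis by (rule that[OF L])
  qed
qed

section \<open>The exponent of a Levy measure under condition A\<close>

lemma one_minus_cos_le: "1 - cos v \<le> 2 * min (v\<^sup>2) 1" for v :: real
proof -
  have "cmod (iexp v - (1 + \<i> * v)) \<le> v\<^sup>2 / 2"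
    using iexp_approx1[of v 1] by (simp add: eval_nat_numeral)
  then have "\<bar>Re (iexp v - (1 + \<i> * v))\<bar> \<le> v\<^sup>2 / 2"
    using abs_Re_le_cmod order_trans by blast
  then have "1 - cos v \<le> v\<^sup>2 / 2" by (simp add: Re_exp)
  moreover have "1 - cos v \<le> 2" using cos_ge_minus_one[of v] by linarith
  moreover have "0 \<le> v\<^sup>2" by simp
  ultimately show ?thesis unfolding min_def by (smt (verit) field_sum_of_halves)
qed

lemma one_minus_cos_ge:
  fixes v :: real assumes "\<bar>v\<bar> \<le> 1" shows "v\<^sup>2 / 4 \<le> 1 - cos v"
proof -
  have "cmod (iexp v - (\<Sum>k\<le>3. (\<i> * v) ^ k / fact k)) \<le> \<bar>v\<bar> ^ 4 / 24"
    using iexp_approx1[of v 3] by (simp add: eval_nat_numeral)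
  then have "\<bar>Re (iexp v - (\<Sum>k\<le>3. (\<i> * v) ^ k / fact k))\<bar> \<le> \<bar>v\<bar> ^ 4 / 24"
    using abs_Re_le_cmod order_trans by blast
  then have "\<bar>cos v - (1 - v\<^sup>2 / 2)\<bar> \<le> \<bar>v\<bar> ^ 4 / 24"
    by (simp add: Re_exp eval_nat_numeral algebra_simps)
  moreover have "\<bar>v\<bar> ^ 4 \<le> v\<^sup>2"
  proof -
    have "\<bar>v\<bar> ^ 4 = v\<^sup>2 * v\<^sup>2" by (simp add: eval_nat_numeral)
    also have "\<dots> \<le> v\<^sup>2 * 1" using assms by (intro mult_left_mono) (auto simp: abs_square_le_1)
    finally show ?thesis by simp
  qed
  ultimately show ?thesis unfolding abs_le_iff by linarith
qed

text \<open>One term of the exponential series suffices: if \<open>\<theta> ^ k > 16\<close>, the \<open>k\<close>-th term of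
  \<open>exp (c * \<theta> ^ n)\<close> already dominates \<open>16 ^ n\<close>.\<close>

lemma geometric_vs_double_exponential:
  fixes \<theta> c :: real assumes "\<theta> > 1" "c > 0"
  obtains S where "S \<ge> 0" "\<And>n. 16 ^ n * exp (- c * \<theta> ^ n) \<le> S"
proof -
  obtain k where k: "16 < \<theta> ^ k" using real_arch_pow[OF assms(1)] by blast
  have "16 ^ n * exp (- c * \<theta> ^ n) \<le> fact k / c ^ k" for n
  proof -
    have "(c * \<theta> ^ n) ^ k / fact k \<le> exp (c * \<theta> ^ n)"
    proof -
      let ?x = "c * \<theta> ^ n"
      have "(\<Sum>i\<in>{k}. ?x ^ i /\<^sub>R fact i) \<le> (\<Sum>i. ?x ^ i /\<^sub>R fact i)"
        using assms by (intro sum_le_suminf) (simp_all add: summable_exp)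
      then show ?thesis by (simp add: exp_def field_simps)
    qed
    moreover have "16 ^ n * c ^ k \<le> (c * \<theta> ^ n) ^ k"
    proof -
      have "16 ^ n \<le> (\<theta> ^ k) ^ n" using k by (intro power_mono) auto
      then show ?thesis using assms by (simp add: power_mult_distrib mult.commute flip: power_mult)
    qed
    ultimately have "16 ^ n * c ^ k \<le> fact k * exp (c * \<theta> ^ n)"
      by (simp add: field_simps)
    then show ?thesis using assms by (simp add: exp_minus field_simps)
  qed
  then show ?thesis using that[of "fact k / c ^ k"] assms by auto
qed

locale levy_jump_measure =
  fixes \<mu> :: "real measure"
  assumes levy: "levy_measure \<mu>"
begin

lemma sets_levy[measurable_cong]: "sets \<mu> = sets borel"
  using levy by (simp add: levy_measure_def)

lemma integrable_levy_min: "integrable \<mu> (\<lambda>u. min 1 (u\<^sup>2))"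
  using levy by (intro integrableI_nonneg) (auto simp: levy_measure_def measurable_cong_sets[OF sets_levy refl])

lemma integrable_levy_bounded:
  fixes f :: "real \<Rightarrow> 'b::{banach, second_countable_topology}"
  assumes "f \<in> borel_measurable borel" "\<And>u. norm (f u) \<le> C * min 1 (u\<^sup>2)"
  shows "integrable \<mu> f"
proof (rule Bochner_Integration.integrable_bound)
  show "integrable \<mu> (\<lambda>u. C * min 1 (u\<^sup>2))" using integrable_levy_min by auto
  show "AE u in \<mu>. norm (f u) \<le> norm (C * min 1 (u\<^sup>2))"
    using assms(2) by (intro AE_I2) (rule order_trans, assumption, simp)
qed (use assms in \<open>simp add: measurable_cong_sets[OF sets_levy refl]\<close>)

lemma min_scaled_square_le: "min ((\<xi> * u)\<^sup>2) 1 \<le> (1 + \<xi>\<^sup>2) * min 1 (u\<^sup>2)" for \<xi> u :: real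
proof (cases "u\<^sup>2 \<le> 1")
  case True
  have "min ((\<xi> * u)\<^sup>2) 1 \<le> \<xi>\<^sup>2 * u\<^sup>2" by (simp add: power_mult_distrib)
  also have "\<dots> \<le> (1 + \<xi>\<^sup>2) * u\<^sup>2" by (simp add: ring_distribs)
  finally show ?thesis using True by (simp add: min_def)
next
  case False
  have "min ((\<xi> * u)\<^sup>2) 1 \<le> 1 + \<xi>\<^sup>2" by (rule order_trans[of _ 1]) auto
  then show ?thesis using False by (simp add: min_def)
qed

lemma integrable_psiU: "integrable \<mu> (\<lambda>u. min ((\<xi> * u)\<^sup>2) 1)"
  by (rule integrable_levy_bounded[where C="1 + \<xi>\<^sup>2"]) (use min_scaled_square_le in auto)

lemma integrable_psiL: "integrable \<mu> (\<lambda>u. indicator {u. \<bar>\<xi> * u\<bar> < 1} u * (\<xi> * u)\<^sup>2)"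
proof (rule Bochner_Integration.integrable_bound[OF integrable_psiU[of \<xi>]])
  show "AE u in \<mu>. norm (indicator {u. \<bar>\<xi> * u\<bar> < 1} u * (\<xi> * u)\<^sup>2) \<le> norm (min ((\<xi> * u)\<^sup>2) 1)"
    by (intro AE_I2) (auto split: split_indicator simp: min_def abs_square_le_1)
qed measurable

lemma integrable_one_minus_cos: "integrable \<mu> (\<lambda>u. 1 - cos (\<xi> * u))"
proof (rule Bochner_Integration.integrable_bound)
  show "integrable \<mu> (\<lambda>u. 2 * min ((\<xi> * u)\<^sup>2) 1)" using integrable_psiU by auto
  show "AE u in \<mu>. norm (1 - cos (\<xi> * u)) \<le> norm (2 * min ((\<xi> * u)\<^sup>2) 1)"
    using one_minus_cos_le[of "\<xi> * u" for u] by (intro AE_I2) (auto simp: abs_le_iff)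
qed measurable

lemma integrable_psi: "integrable \<mu> (\<lambda>u. 1 - iexp (\<xi> * u) + \<i> * \<xi> * u * indicator {u. \<bar>u\<bar> < 1} u)"
proof (rule integrable_levy_bounded[where C="2 + \<xi>\<^sup>2"])
  fix u :: real
  show "norm (1 - iexp (\<xi> * u) + \<i> * \<xi> * u * indicator {u. \<bar>u\<bar> < 1} u) \<le> (2 + \<xi>\<^sup>2) * min 1 (u\<^sup>2)"
  proof (cases "\<bar>u\<bar> < 1")
    case True
    then have "u\<^sup>2 < 1" by (simp add: abs_square_less_1)
    show ?thesis
    proof -
      have "norm (1 - iexp (\<xi> * u) + \<i> * \<xi> * u * indicator {u. \<bar>u\<bar> < 1} u) \<le> (\<xi> * u)\<^sup>2 / 2"
        using True norm_compensated_iexp_le[of "\<xi> * u"] by (simp add: mult.assoc)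
      also have "\<dots> \<le> (2 + \<xi>\<^sup>2) * u\<^sup>2"
        using mult_nonneg_nonneg[OF zero_le_power2[of \<xi>] zero_le_power2[of u]] zero_le_power2[of u] unfolding power_mult_distrib ring_distribs by linarith
      finally show ?thesis using \<open>u\<^sup>2 < 1\<close> by (simp add: min_def)
    qed
  next
    case False
    then have "min 1 (u\<^sup>2) = 1" using abs_square_less_1[of u] by auto
    moreover have "norm (1 - iexp (\<xi> * u)) \<le> 2"
      by (rule order_trans[OF norm_triangle_ineq4]) simp
    ultimately show ?thesis using False by (auto simp: indicator_def intro: order_trans)
  qed
qed measurable

lemma Re_psi: "Re (psi a \<mu> \<xi>) = (LINT u|\<mu>. 1 - cos (\<xi> * u))"
proof -
  have "Re (psi a \<mu> \<xi>) = (LINT u|\<mu>. Re (1 - iexp (\<xi> * u) + \<i> * \<xi> * u * indicator {u. \<bar>u\<bar> < 1} u))"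
    unfolding psi_def by (subst integral_Re[OF integrable_psi]) simp
  also have "\<dots> = (LINT u|\<mu>. 1 - cos (\<xi> * u))"
    by (intro Bochner_Integration.integral_cong) (auto simp: Re_exp split: split_indicator)
  finally show ?thesis .
qed

lemma Re_psi_le_psiU: "Re (psi a \<mu> \<xi>) \<le> 2 * psiU \<mu> \<xi>"
proof -
  have "(LINT u|\<mu>. 1 - cos (\<xi> * u)) \<le> (LINT u|\<mu>. 2 * min ((\<xi> * u)\<^sup>2) 1)"
    by (intro integral_mono) (use integrable_one_minus_cos integrable_psiU one_minus_cos_le in auto)
  then show ?thesis by (simp add: Re_psi psiU_def)
qed

lemma psiL_le_Re_psi: "psiL \<mu> \<xi> \<le> 4 * Re (psi a \<mu> \<xi>)"
proof -
  have "psiL \<mu> \<xi> = (LINT u|\<mu>. indicator {u. \<bar>\<xi> * u\<bar> < 1} u * (\<xi> * u)\<^sup>2)"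
    by (simp add: psiL_def set_lebesgue_integral_def)
  also have "\<dots> \<le> (LINT u|\<mu>. 4 * (1 - cos (\<xi> * u)))"
  proof (intro integral_mono integrable_psiL)
    show "integrable \<mu> (\<lambda>u. 4 * (1 - cos (\<xi> * u)))" using integrable_one_minus_cos by (intro integrable_mult_right)
    show "indicator {u. \<bar>\<xi> * u\<bar> < 1} u * (\<xi> * u)\<^sup>2 \<le> 4 * (1 - cos (\<xi> * u))" for u
      using one_minus_cos_ge[of "\<xi> * u"] by (auto split: split_indicator)
  qed
  finally show ?thesis unfolding Re_psi by (subst (asm) integral_mult_right_zero)
qed

lemma psiU_mono: "\<bar>\<xi>\<bar> \<le> \<bar>\<eta>\<bar> \<Longrightarrow> psiU \<mu> \<xi> \<le> psiU \<mu> \<eta>"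
  unfolding psiU_def
  by (intro integral_mono integrable_psiU min.mono)
     (auto simp: power_mult_distrib abs_le_square_iff intro!: mult_right_mono)

text \<open>This replaces the differential relation \<open>\<xi> * \<psi>\<^sup>U'(\<xi>) = 2 * \<psi>\<^sup>L(\<xi>)\<close>. Pointwise, doubling \<open>\<xi>\<close> multiplies
  \<open>(\<xi> * u)\<^sup>2\<close> by four as long as \<open>\<bar>2 * \<xi> * u\<bar> < 1\<close>, which is a gain of three quarters of the new value.\<close>

lemma psiU_double: "psiU \<mu> \<xi> + 3 / 4 * psiL \<mu> (2 * \<xi>) \<le> psiU \<mu> (2 * \<xi>)"
proof -
  have "psiU \<mu> \<xi> + 3 / 4 * psiL \<mu> (2 * \<xi>) =
    (LINT u|\<mu>. min ((\<xi> * u)\<^sup>2) 1 + 3 / 4 * (indicator {u. \<bar>2 * \<xi> * u\<bar> < 1} u * (2 * \<xi> * u)\<^sup>2))"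
    unfolding psiU_def psiL_def set_lebesgue_integral_def
    using integrable_psiU integrable_psiL[of "2 * \<xi>"]
    by (subst Bochner_Integration.integral_add) auto
  also have "\<dots> \<le> psiU \<mu> (2 * \<xi>)"
    unfolding psiU_def
  proof (intro integral_mono)
    show "integrable \<mu> (\<lambda>u. min ((\<xi> * u)\<^sup>2) 1 + 3 / 4 * (indicator {u. \<bar>2 * \<xi> * u\<bar> < 1} u * (2 * \<xi> * u)\<^sup>2))"
      using integrable_psiU integrable_psiL[of "2 * \<xi>"] by auto
    fix u
    have "(2 * \<xi> * u)\<^sup>2 = 4 * (\<xi> * u)\<^sup>2" by (simp add: power2_eq_square)
    moreover have "\<bar>2 * \<xi> * u\<bar> < 1 \<longleftrightarrow> (2 * \<xi> * u)\<^sup>2 < 1" by (simp add: abs_square_less_1)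
    ultimately show "min ((\<xi> * u)\<^sup>2) 1 + 3 / 4 * (indicator {u. \<bar>2 * \<xi> * u\<bar> < 1} u * (2 * \<xi> * u)\<^sup>2) \<le> min ((2 * \<xi> * u)\<^sup>2) 1"
      by (auto split: split_indicator simp: min_def)
  qed (rule integrable_psiU)
  finally show ?thesis .
qed

text \<open>Otherwise \<open>\<mu>\<close> would be concentrated at 0, where it has no mass.\<close>

lemma psiU_pos:
  assumes "emeasure \<mu> UNIV = \<infinity>" shows "psiU \<mu> 1 > 0"
proof (rule ccontr)
  assume "\<not> psiU \<mu> 1 > 0"
  moreover have "0 \<le> (LINT u|\<mu>. min ((1 * u)\<^sup>2) 1)" by (rule Bochner_Integration.integral_nonneg) auto
  ultimately have "psiU \<mu> 1 = 0" unfolding psiU_def by linarith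
  then have "AE u in \<mu>. min ((1 * u)\<^sup>2) 1 = 0"
    unfolding psiU_def using integrable_psiU[of 1] by (subst (asm) integral_nonneg_eq_0_iff_AE) auto
  then have "AE u in \<mu>. u \<notin> UNIV - {0}" by eventually_elim (auto simp: min_def split: if_splits)
  then have "emeasure \<mu> (UNIV - {0}) = 0"
    by (subst (asm) AE_iff_null_sets[symmetric]) (auto simp: sets_levy)
  moreover have "emeasure \<mu> UNIV \<le> emeasure \<mu> (UNIV - {0}) + emeasure \<mu> {0}"
    using emeasure_subadditive[of "UNIV - {0::real}" \<mu> "{0}"] by (simp add: sets_levy)
  moreover have "emeasure \<mu> {0} = 0" using levy by (simp add: levy_measure_def)
  ultimately show False using assms by simp
qed

lemma continuous_Re_psi: "continuous_on UNIV (\<lambda>\<xi>. Re (psi a \<mu> \<xi>))"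
proof -
  have "isCont (\<lambda>\<xi>. LINT u|\<mu>. 1 - cos (\<xi> * u)) x" for x
    unfolding continuous_at_sequentially comp_def
  proof safe
    fix X assume X: "X \<longlonglongrightarrow> x"
    then obtain C where C: "\<And>n. \<bar>X n\<bar> \<le> C"
      using Bseq_def convergentI convergent_imp_Bseq by (metis real_norm_def)
    show "(\<lambda>n. LINT u|\<mu>. 1 - cos (X n * u)) \<longlonglongrightarrow> (LINT u|\<mu>. 1 - cos (x * u))"
    proof (rule integral_dominated_convergence[where w="\<lambda>u. 2 * min ((C * u)\<^sup>2) 1"])
      show "integrable \<mu> (\<lambda>u. 2 * min ((C * u)\<^sup>2) 1)" using integrable_psiU by auto
      show "AE u in \<mu>. (\<lambda>n. 1 - cos (X n * u)) \<longlonglongrightarrow> 1 - cos (x * u)"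
        by (intro AE_I2 tendsto_intros X)
      show "AE u in \<mu>. norm (1 - cos (X n * u)) \<le> 2 * min ((C * u)\<^sup>2) 1" for n
      proof (rule AE_I2)
        fix u
        have "norm (1 - cos (X n * u)) \<le> 2 * min ((X n * u)\<^sup>2) 1"
          using one_minus_cos_le[of "X n * u"] by (simp add: abs_le_iff)
        also have "\<dots> \<le> 2 * min ((C * u)\<^sup>2) 1"
          using C[of n] abs_le_square_iff[of "X n" C]
          by (intro mult_left_mono min.mono) (auto simp: power_mult_distrib intro!: mult_right_mono)
        finally show "norm (1 - cos (X n * u)) \<le> 2 * min ((C * u)\<^sup>2) 1" .
      qed
    qed measurable
  qed
  then show ?thesis unfolding Re_psi by (simp add: continuous_on_eq_continuous_at)
qed

end

locale condition_A_measure = levy_jump_measure +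
  fixes \<beta> :: real
  assumes \<beta>: "\<beta> > 1" and A: "\<And>\<xi>. psiU \<mu> \<xi> \<le> \<beta> * psiL \<mu> \<xi>"
    and inf: "emeasure \<mu> UNIV = \<infinity>"
begin

lemma psiU_le_Re_psi: "psiU \<mu> \<xi> \<le> 4 * \<beta> * Re (psi a \<mu> \<xi>)"
proof -
  have "\<beta> * psiL \<mu> \<xi> \<le> \<beta> * (4 * Re (psi a \<mu> \<xi>))"
    using \<beta> by (intro mult_left_mono psiL_le_Re_psi) auto
  then show ?thesis using A[of \<xi>] by simp
qed

text \<open>Under condition A the gain in one doubling is a fixed fraction of the whole, so \<open>\<psi>\<^sup>U\<close> grows at least
  like a positive power of \<open>\<xi>\<close>.\<close>

lemma psiU_geometric_growth: "(1 / (1 - 3 / (4 * \<beta>))) ^ n * psiU \<mu> \<xi> \<le> psiU \<mu> (2 ^ n * \<xi>)"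
proof (induction n)
  case (Suc n)
  define c where "c = 1 - 3 / (4 * \<beta>)"
  have c: "c > 0" using \<beta> by (simp add: c_def field_simps)
  let ?\<eta> = "2 ^ n * \<xi>"
  have "psiU \<mu> (2 * ?\<eta>) / \<beta> \<le> psiL \<mu> (2 * ?\<eta>)"
    using A[of "2 * ?\<eta>"] \<beta> by (simp add: divide_le_eq mult.commute)
  then have "psiU \<mu> ?\<eta> \<le> c * psiU \<mu> (2 * ?\<eta>)"
    using psiU_double[of ?\<eta>] by (simp add: c_def algebra_simps)
  then have "1 / c * psiU \<mu> ?\<eta> \<le> psiU \<mu> (2 * ?\<eta>)" using c by (simp add: field_simps)
  moreover have "1 / c * ((1 / c) ^ n * psiU \<mu> \<xi>) \<le> 1 / c * psiU \<mu> ?\<eta>"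
    using Suc.IH c by (intro mult_left_mono) (auto simp: c_def)
  ultimately show ?case by (simp add: c_def mult.assoc)
qed simp

lemma growth_factor_gt_1: "1 / (1 - 3 / (4 * \<beta>)) > 1"
  using \<beta> by (simp add: field_simps)

text \<open>The growth of \<open>\<psi>\<^sup>U\<close> makes the set in the definition of \<open>\<rho>\<^sub>t\<close> nonempty; continuity of the real part of
  \<open>\<psi>\<close>, which vanishes at 0, makes its infimum positive and the value there exactly \<open>1 / t\<close>.\<close>

lemma rho_properties:
  assumes t: "t > 0"
  shows "rho a \<mu> t > 0" "Re (psi a \<mu> (rho a \<mu> t)) = 1 / t"
proof -
  define S where "S = {\<xi>. \<xi> > 0 \<and> Re (psi a \<mu> \<xi>) \<ge> 1 / t}"
  define R where "R = (\<lambda>\<xi>. Re (psi a \<mu> \<xi>))"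
  let ?\<theta> = "1 / (1 - 3 / (4 * \<beta>))"
  have contR: "continuous_on UNIV R" unfolding R_def by (rule continuous_Re_psi)
  \<comment> \<open>after \<open>n\<close> doublings of 1 the growth beats the constant \<open>4 * \<beta>\<close> that compares \<open>\<psi>\<^sup>U\<close> with \<open>Re \<psi>\<close>\<close>
  obtain n where n: "4 * \<beta> / (t * psiU \<mu> 1) < ?\<theta> ^ n"
    using real_arch_pow[OF growth_factor_gt_1] by blast
  have "4 * \<beta> / t < ?\<theta> ^ n * psiU \<mu> 1"
    using n t psiU_pos[OF inf] by (simp add: field_simps)
  also have "\<dots> \<le> psiU \<mu> (2 ^ n * 1)" by (rule psiU_geometric_growth)
  also have "\<dots> \<le> 4 * \<beta> * Re (psi a \<mu> (2 ^ n))" using psiU_le_Re_psi[of "2 ^ n"] by simp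
  finally have "(4 * \<beta>) * (1 / t) < (4 * \<beta>) * Re (psi a \<mu> (2 ^ n))" by simp
  then have "1 / t < Re (psi a \<mu> (2 ^ n))" using \<beta> by (subst (asm) mult_less_cancel_left_pos) auto
  then have ne: "S \<noteq> {}" by (auto simp: S_def intro!: exI[of _ "2 ^ n"])
  have bdd: "bdd_below S" by (auto simp: S_def bdd_below_def intro: less_imp_le)
  have rho: "rho a \<mu> t = Inf S" by (simp add: rho_def S_def)
  have "closed {\<xi>. 1 / t \<le> R \<xi>}"
    using contR by (intro closed_Collect_le) auto
  moreover have "S \<subseteq> {\<xi>. 1 / t \<le> R \<xi>}" by (auto simp: S_def R_def)
  ultimately have "closure S \<subseteq> {\<xi>. 1 / t \<le> R \<xi>}" by (metis closure_minimal)
  then have ge: "1 / t \<le> R (Inf S)" using closure_contains_Inf[OF ne bdd] by auto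
  have nn: "Inf S \<ge> 0" using ne by (intro cInf_greatest) (auto simp: S_def)
  have "R 0 = 0" by (simp add: R_def Re_psi)
  then have "Inf S \<noteq> 0" using ge t by (metis divide_le_eq_1_pos less_le_not_le zero_less_divide_1_iff)
  then have pos: "Inf S > 0" using nn by simp
  have "R (Inf S) \<le> 1 / t"
  proof (rule tendsto_upperbound)
    show "(R \<longlongrightarrow> R (Inf S)) (at_left (Inf S))"
      using contR by (metis UNIV_I continuous_on_def subset_UNIV tendsto_within_subset)
    have "eventually (\<lambda>x. x \<in> {0<..<Inf S}) (at_left (Inf S))"
      by (rule eventually_at_left_real[OF pos])
    then show "eventually (\<lambda>x. R x \<le> 1 / t) (at_left (Inf S))"
    proof eventually_elim
      case (elim x)
      then have "x \<notin> S" using bdd by (metis cInf_lower greaterThanLessThan_iff not_le)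
      then show ?case using elim by (auto simp: S_def R_def)
    qed
  qed simp
  then show "rho a \<mu> t > 0" "Re (psi a \<mu> (rho a \<mu> t)) = 1 / t"
    using pos ge rho by (auto simp: R_def)
qed

end

section \<open>Uniform bounds and convolutions of densities\<close>

lemma integrable_inverse_1_plus_square_lborel: "integrable lborel (\<lambda>s::real. 1 / (1 + s\<^sup>2))"
  using integrable_inverse_1_plus_square by (simp add: set_integrable_def einterval_def inverse_eq_divide)

text \<open>The kernel that dominates all rescaled characteristic functions: it decays fast enough for a
  Lipschitz density.\<close>

lemma integrable_quartic_kernel:
  "integrable lborel (\<lambda>s::real. K / (1 + s\<^sup>2)\<^sup>2)" "integrable lborel (\<lambda>s::real. \<bar>s\<bar> * (K / (1 + s\<^sup>2)\<^sup>2))"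
proof -
  have p: "1 + s\<^sup>2 > 0" "1 \<le> 1 + s\<^sup>2" "\<bar>s\<bar> \<le> 1 + s\<^sup>2" for s :: real
  proof -
    show "1 + s\<^sup>2 > 0" by (simp add: add_pos_nonneg)
    show "1 \<le> 1 + s\<^sup>2" by simp
    have "0 \<le> (\<bar>s\<bar> - 1)\<^sup>2" by simp
    then have "2 * \<bar>s\<bar> \<le> 1 + s\<^sup>2" by (simp add: power2_diff)
    then show "\<bar>s\<bar> \<le> 1 + s\<^sup>2" by simp
  qed
  have I: "integrable lborel (\<lambda>s::real. \<bar>K\<bar> * (1 / (1 + s\<^sup>2)))"
    using integrable_inverse_1_plus_square_lborel by (rule integrable_mult_right)
  have le: "c * (\<bar>K\<bar> / (1 + s\<^sup>2)\<^sup>2) \<le> \<bar>K\<bar> * (1 / (1 + s\<^sup>2))" if "c \<le> 1 + s\<^sup>2" for c s :: real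
  proof -
    have "c * (\<bar>K\<bar> / (1 + s\<^sup>2)\<^sup>2) \<le> (1 + s\<^sup>2) * (\<bar>K\<bar> / (1 + s\<^sup>2)\<^sup>2)"
      using that by (intro mult_right_mono) auto
    also have "\<dots> = \<bar>K\<bar> * (1 / (1 + s\<^sup>2))" using p(1)[of s] by (simp add: power2_eq_square)
    finally show ?thesis .
  qed
  show "integrable lborel (\<lambda>s::real. K / (1 + s\<^sup>2)\<^sup>2)"
    by (rule Bochner_Integration.integrable_bound[OF I]) (use le[OF p(2)] in \<open>auto simp: abs_mult\<close>)
  show "integrable lborel (\<lambda>s::real. \<bar>s\<bar> * (K / (1 + s\<^sup>2)\<^sup>2))"
    by (rule Bochner_Integration.integrable_bound[OF I]) (use le[OF p(3)] in \<open>auto simp: abs_mult\<close>)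
qed

text \<open>The scaled version of the inversion theorem. The constants depend on \<open>K\<close> alone, because the
  substitution \<open>\<xi> = r * s\<close> produces exactly one factor \<open>r\<close> in the bound of the density and two in its
  Lipschitz constant.\<close>

lemma density_of_char_bound:
  fixes K :: real assumes "K > 0"
  obtains B L where "B > 0" "L > 0"
    "\<And>N r. \<lbrakk>real_distribution N; r > 0; \<And>\<xi>. norm (char N \<xi>) \<le> K / (1 + (\<xi> / r)\<^sup>2)\<^sup>2\<rbrakk> \<Longrightarrow>
      \<exists>q. continuous_on UNIV q \<and> (\<forall>x. 0 \<le> q x) \<and> N = density lborel (\<lambda>x. ennreal (q x)) \<and>
        (\<forall>x. q x \<le> B * r) \<and> (\<forall>x y. \<bar>q x - q y\<bar> \<le> L * r\<^sup>2 * \<bar>x - y\<bar>)"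
proof -
  define g where "g s = K / (1 + s\<^sup>2)\<^sup>2" for s :: real
  have g0: "g s \<ge> 0" for s using assms by (simp add: g_def)
  have Ig: "integrable lborel g" "integrable lborel (\<lambda>s. \<bar>s\<bar> * g s)"
    using integrable_quartic_kernel[of K] by (simp_all add: g_def[abs_def])
  \<comment> \<open>the summand 1 only makes the constants positive\<close>
  define B where "B = (LINT s|lborel. g s) + 1"
  define L where "L = (LINT s|lborel. \<bar>s\<bar> * g s) + 1"
  have BL: "B > 0" "L > 0" unfolding B_def L_def
    by (auto intro!: add_nonneg_pos Bochner_Integration.integral_nonneg mult_nonneg_nonneg g0)
  show ?thesis
  proof (rule that[OF BL])
    fix N and r :: real
    assume N: "real_distribution N" and r: "r > 0" and b: "\<And>\<xi>. norm (char N \<xi>) \<le> K / (1 + (\<xi> / r)\<^sup>2)\<^sup>2"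
    interpret real_distribution N by (rule N)
    have b': "norm (char N \<xi>) \<le> g (\<xi> / r)" for \<xi> using b by (simp add: g_def)
    have r1: "1 / r \<noteq> 0" using r by simp
    have J1: "integrable lborel (\<lambda>\<xi>. g (\<xi> / r))"
      using lborel_integrable_real_affine[OF Ig(1) r1, of 0] by simp
    have J2: "integrable lborel (\<lambda>\<xi>. \<bar>\<xi>\<bar> * g (\<xi> / r))"
    proof -
      have "integrable lborel (\<lambda>\<xi>. r * (\<bar>\<xi> / r\<bar> * g (\<xi> / r)))"
        using lborel_integrable_real_affine[OF Ig(2) r1, of 0] by (intro integrable_mult_right) simp
      moreover have "r * (\<bar>\<xi> / r\<bar> * g (\<xi> / r)) = \<bar>\<xi>\<bar> * g (\<xi> / r)" for \<xi> using r by (simp add: abs_divide)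
      ultimately show ?thesis by (simp only:)
    qed
    have v1: "(LINT \<xi>|lborel. g (\<xi> / r)) = r * (LINT s|lborel. g s)"
      using lborel_integral_real_affine[OF r1, of g 0] r by (simp add: field_simps)
    have v2: "(LINT \<xi>|lborel. \<bar>\<xi>\<bar> * g (\<xi> / r)) = r\<^sup>2 * (LINT s|lborel. \<bar>s\<bar> * g s)"
    proof -
      have "(LINT s|lborel. \<bar>s\<bar> * g s) = (1 / r) * (LINT \<xi>|lborel. \<bar>\<xi> / r\<bar> * g (\<xi> / r))"
        using lborel_integral_real_affine[OF r1, of "\<lambda>s. \<bar>s\<bar> * g s" 0] r by simp
      also have "(LINT \<xi>|lborel. \<bar>\<xi> / r\<bar> * g (\<xi> / r)) = (LINT \<xi>|lborel. \<bar>\<xi>\<bar> * g (\<xi> / r)) / r"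
        using r by simp
      finally show ?thesis using r by (simp add: power2_eq_square)
    qed
    have I1: "integrable lborel (char N)"
      by (rule Bochner_Integration.integrable_bound[OF J1]) (use b' g0 in auto)
    have I2: "integrable lborel (\<lambda>t. \<bar>t\<bar> * norm (char N t))"
      by (rule Bochner_Integration.integrable_bound[OF J2]) (use b' g0 in \<open>auto simp: abs_mult intro!: mult_left_mono\<close>)
    from fourier_density[OF I1 I2] obtain q where q: "continuous_on UNIV q" "\<And>x. 0 \<le> q x"
      "N = density lborel (\<lambda>x. ennreal (q x))" "\<And>x. q x \<le> (LINT t|lborel. norm (char N t))"
      "\<And>x y. \<bar>q x - q y\<bar> \<le> (LINT t|lborel. \<bar>t\<bar> * norm (char N t)) * \<bar>x - y\<bar>" by blast
    have "(LINT t|lborel. norm (char N t)) \<le> (LINT \<xi>|lborel. g (\<xi> / r))"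
      by (intro integral_mono) (use I1 J1 b' in auto)
    also have "\<dots> \<le> B * r" using r by (simp add: v1 B_def algebra_simps)
    finally have e1: "(LINT t|lborel. norm (char N t)) \<le> B * r" .
    have "(LINT t|lborel. \<bar>t\<bar> * norm (char N t)) \<le> (LINT \<xi>|lborel. \<bar>\<xi>\<bar> * g (\<xi> / r))"
      by (intro integral_mono) (use I2 J2 b' in \<open>auto intro!: mult_left_mono\<close>)
    also have "\<dots> \<le> L * r\<^sup>2" using r by (simp add: v2 L_def algebra_simps)
    finally have e2: "(LINT t|lborel. \<bar>t\<bar> * norm (char N t)) \<le> L * r\<^sup>2" .
    have "q x \<le> B * r" for x using q(4)[of x] e1 by linarith
    moreover have "\<bar>q x - q y\<bar> \<le> L * r\<^sup>2 * \<bar>x - y\<bar>" for x y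
      using q(5)[of x y] mult_right_mono[OF e2, of "\<bar>x - y\<bar>"] by linarith
    ultimately show "\<exists>q. continuous_on UNIV q \<and> (\<forall>x. 0 \<le> q x) \<and> N = density lborel (\<lambda>x. ennreal (q x)) \<and>
        (\<forall>x. q x \<le> B * r) \<and> (\<forall>x y. \<bar>q x - q y\<bar> \<le> L * r\<^sup>2 * \<bar>x - y\<bar>)"
      using q by blast
  qed
qed

text \<open>The set of maximisers is compact, hence has a least element. The bound on \<open>q x * \<bar>x\<bar>\<close> is a weak form of
  decay that keeps superlevel sets bounded.\<close>

lemma least_maximiser:
  fixes q :: "real \<Rightarrow> real"
  assumes cont: "continuous_on UNIV q" and x0: "q x0 > 0" and decay: "\<And>x. q x * \<bar>x\<bar> \<le> C"
  shows "\<forall>x'. q x' \<le> q (LEAST x. \<forall>x'. q x' \<le> q x)"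
proof -
  have closed: "closed {x. c \<le> q x}" for c
    using cont by (intro closed_Collect_le) auto
  have sub: "{x. q x0 \<le> q x} \<subseteq> {- (C / q x0)..C / q x0}"
  proof safe
    fix x assume "q x0 \<le> q x"
    then have "q x0 * \<bar>x\<bar> \<le> C" using decay[of x] mult_right_mono[of "q x0" "q x" "\<bar>x\<bar>"] by simp
    then have "\<bar>x\<bar> \<le> C / q x0" using x0 by (simp add: field_simps)
    then show "x \<in> {- (C / q x0)..C / q x0}" by auto
  qed
  have "compact {x. q x0 \<le> q x}"
    using closed bounded_subset[OF _ sub] by (simp add: compact_eq_bounded_closed)
  then obtain m where m: "q x0 \<le> q m" "\<And>x. q x0 \<le> q x \<Longrightarrow> q x \<le> q m"
    using continuous_attains_sup[of "{x. q x0 \<le> q x}" q] continuous_on_subset[OF cont] by blast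
  have max: "q x \<le> q m" for x using m by (meson linear order_trans)
  define S where "S = {x. q m \<le> q x}"
  have S: "closed S" "S \<noteq> {}" "bdd_below S"
  proof -
    show "closed S" unfolding S_def by (rule closed)
    show "S \<noteq> {}" by (auto simp: S_def)
    have "S \<subseteq> {- (C / q x0)..C / q x0}" unfolding S_def using m(1) by (intro order_trans[OF _ sub]) auto
    then show "bdd_below S" by (meson bdd_below_Icc bdd_below_mono)
  qed
  have "Inf S \<in> S" by (rule closed_contains_Inf) (use S in auto)
  have "(LEAST x. \<forall>x'. q x' \<le> q x) = Inf S"
  proof (rule Least_equality)
    show "\<forall>x'. q x' \<le> q (Inf S)" using \<open>Inf S \<in> S\<close> max by (auto simp: S_def intro: order_trans)
    show "Inf S \<le> y" if "\<forall>x'. q x' \<le> q y" for y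
      using that S by (intro cInf_lower) (auto simp: S_def)
  qed
  then show ?thesis using \<open>Inf S \<in> S\<close> max by (auto simp: S_def intro: order_trans)
qed

text \<open>At least half of the mass lies within distance \<open>ln (4 * E) / r\<close> of the origin, so the density cannot be
  small throughout that interval.\<close>

lemma max_density_lower_bound:
  assumes N: "real_distribution N" "N = density lborel (\<lambda>x. ennreal (q x))"
    and meas: "q \<in> borel_measurable borel" and r: "r > 0" and E: "E \<ge> 1"
    and mom: "(\<integral>\<^sup>+x. exp (r * x) \<partial>N) \<le> ennreal E" "(\<integral>\<^sup>+x. exp (- r * x) \<partial>N) \<le> ennreal E"
    and M: "\<And>x. q x \<le> M"
  shows "r / (4 * ln (4 * E)) \<le> M"
proof -
  interpret N: real_distribution N by (rule N)
  \<comment> \<open>at this distance the tail bound \<open>2 * E * exp (- r * b)\<close> equals one half\<close>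
  define b where "b = ln (4 * E) / r"
  have l: "ln (4 * E) > 0" using E by simp
  then have b: "b > 0" using r by (simp add: b_def)
  have "exp (- (r * b)) = 1 / (4 * E)" using r E by (simp add: b_def exp_minus field_simps)
  then have "1 / 2 \<le> measure N {-b<..b}"
    using two_sided_tail_bound[OF N(1) r mom, of b] E by simp
  then have "ennreal (1 / 2) \<le> emeasure N {-b<..b}" unfolding N.emeasure_eq_measure by (rule ennreal_leI)
  also have "\<dots> = (\<integral>\<^sup>+x. ennreal (q x) * indicator {-b<..b} x \<partial>lborel)"
    unfolding N(2) using meas by (subst emeasure_density) auto
  also have "\<dots> \<le> (\<integral>\<^sup>+x. ennreal M * indicator {-b<..b} x \<partial>lborel)"
    by (intro nn_integral_mono mult_right_mono ennreal_leI M) auto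
  also have "\<dots> = ennreal M * ennreal (2 * b)" using b by (subst nn_integral_cmult_indicator) auto
  finally have *: "ennreal (1 / 2) \<le> ennreal M * ennreal (2 * b)" .
  have "M \<ge> 0"
  proof (rule ccontr)
    assume "\<not> M \<ge> 0"
    then have "ennreal M = 0" by (simp add: ennreal_neg)
    then show False using * by simp
  qed
  then have "ennreal (1 / 2) \<le> ennreal (M * (2 * b))" using * b by (subst ennreal_mult) auto
  then have "1 / 2 \<le> M * (2 * b)" using b \<open>M \<ge> 0\<close> by (subst (asm) ennreal_le_iff) auto
  then show ?thesis using r l by (simp add: b_def field_simps)
qed

text \<open>Convolving a law that has a bounded continuous density with any other law gives again a continuous
  density. The hypothesis on characteristic functions says that \<open>Y\<close> is the convolution of
  \<open>N\<close> and \<open>P\<close>, shifted to the left by \<open>c\<close>.\<close>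

lemma cont_density_convolution_shift:
  assumes N: "real_distribution N" "N = density lborel (\<lambda>x. ennreal (q x))" and P: "real_distribution P"
    and q: "continuous_on UNIV q" "\<And>x. 0 \<le> q x" "\<And>x. q x \<le> B"
    and Y: "real_distribution Y" "\<And>\<xi>. char Y \<xi> = iexp (- (\<xi> * c)) * char N \<xi> * char P \<xi>"
  shows "cont_density Y x = (LINT y|P. q (x + c - y))"
proof -
  interpret N: real_distribution N by (rule N)
  interpret P: real_distribution P by (rule P)
  interpret NP: pair_sigma_finite P lborel ..
  have [measurable]: "q \<in> borel_measurable borel" by (rule borel_measurable_continuous_onI[OF q(1)])
  have [measurable_cong]: "sets P = sets borel" "sets N = sets borel" by simp_all
  have fin: "finite_measure N" "finite_measure P" by unfold_locales
  interpret C: prob_space "N \<star> P"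
  proof
    have "emeasure (N \<star> P) UNIV = (\<integral>\<^sup>+x. 1 \<partial>(N \<star> P))" by simp
    also have "\<dots> = 1" using fin
      by (subst nn_integral_convolution) (auto simp: N.emeasure_space_1[simplified] P.emeasure_space_1[simplified])
    finally show "emeasure (N \<star> P) (space (N \<star> P)) = 1" by simp
  qed
  let ?W = "distr (N \<star> P) borel (\<lambda>x. x - c)"
  let ?g = "\<lambda>x. LINT y|P. q (x + c - y)"
  have Wd: "real_distribution ?W"
    by (auto simp: real_distribution_def real_distribution_axioms_def intro!: C.prob_space_distr)
  have "Y = ?W"
  proof (rule Levy_uniqueness[OF Y(1) Wd], rule ext)
    fix \<xi>
    have "char ?W \<xi> = (CLINT x|N \<star> P. iexp (- (\<xi> * c)) * iexp (\<xi> * x))"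
      unfolding char_def by (subst integral_distr) (auto simp: mult_exp_exp algebra_simps)
    also have "\<dots> = iexp (- (\<xi> * c)) * char (N \<star> P) \<xi>" by (simp add: char_def)
    also have "\<dots> = char Y \<xi>" using fin by (simp add: char_convolution Y(2))
    finally show "char Y \<xi> = char ?W \<xi>" by simp
  qed
  have gI: "integrable P (\<lambda>y. q (x + c - y))" for x
    by (rule P.integrable_const_bound[where B=B]) (use q in auto)
  have g0: "?g x \<ge> 0" for x using q by (intro Bochner_Integration.integral_nonneg) auto
  have gcont: "continuous_on UNIV ?g"
  proof -
    have "isCont ?g x" for x
      unfolding continuous_at_sequentially comp_def
    proof safe
      fix X assume X: "X \<longlonglongrightarrow> x"
      have qc: "isCont q z" for z using q(1) by (simp add: continuous_on_eq_continuous_at)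
      show "(\<lambda>n. ?g (X n)) \<longlonglongrightarrow> ?g x"
      proof (rule integral_dominated_convergence[where w="\<lambda>_. B"])
        show "AE y in P. (\<lambda>n. q (X n + c - y)) \<longlonglongrightarrow> q (x + c - y)"
          by (intro AE_I2 isCont_tendsto_compose[OF qc] tendsto_intros X)
      qed (use q in auto)
    qed
    then show ?thesis by (simp add: continuous_on_eq_continuous_at)
  qed
  have "Y = density lborel (\<lambda>x. ennreal (?g x))"
  proof (rule measure_eqI)
    show "sets Y = sets (density lborel (\<lambda>x. ennreal (?g x)))" by (simp add: \<open>Y = ?W\<close>)
    fix A assume "A \<in> sets Y"
    then have A[measurable]: "A \<in> sets borel" by (simp add: \<open>Y = ?W\<close>)
    have "emeasure Y A = (\<integral>\<^sup>+z. indicator A (z - c) \<partial>(N \<star> P))"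
      unfolding \<open>Y = ?W\<close> by (subst nn_integral_indicator[symmetric], simp, subst nn_integral_distr) auto
    also have "(N \<star> P) = (P \<star> N)" using fin by (intro convolution_commutative) auto
    also have "(\<integral>\<^sup>+z. indicator A (z - c) \<partial>(P \<star> N)) = (\<integral>\<^sup>+y. \<integral>\<^sup>+x. indicator A (y + x - c) \<partial>N \<partial>P)"
      using fin by (subst nn_integral_convolution) auto
    also have "\<dots> = (\<integral>\<^sup>+y. \<integral>\<^sup>+x. ennreal (q x) * indicator A (y + x - c) \<partial>lborel \<partial>P)"
      unfolding N(2) by (subst nn_integral_density) auto
    also have "\<dots> = (\<integral>\<^sup>+y. \<integral>\<^sup>+x. ennreal (q (x + c - y)) * indicator A x \<partial>lborel \<partial>P)"
    proof (rule nn_integral_cong)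
      fix y
      show "(\<integral>\<^sup>+x. ennreal (q x) * indicator A (y + x - c) \<partial>lborel) = (\<integral>\<^sup>+x. ennreal (q (x + c - y)) * indicator A x \<partial>lborel)"
        using nn_integral_real_affine[of "\<lambda>x. ennreal (q x) * indicator A (y + x - c)" 1 "c - y"]
        by (simp add: algebra_simps)
    qed
    also have "\<dots> = (\<integral>\<^sup>+x. \<integral>\<^sup>+y. ennreal (q (x + c - y)) * indicator A x \<partial>P \<partial>lborel)"
    proof (rule NP.Fubini'[symmetric])
      have "(\<lambda>z. ennreal (q (snd z + c - fst z)) * indicator A (snd z)) \<in> borel_measurable (borel \<Otimes>\<^sub>M borel)"
        by measurable
      also have "borel_measurable (borel \<Otimes>\<^sub>M borel) = borel_measurable (P \<Otimes>\<^sub>M lborel)"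
        by (intro measurable_cong_sets sets_pair_measure_cong) auto
      finally show "(\<lambda>(y, x). ennreal (q (x + c - y)) * indicator A x) \<in> borel_measurable (P \<Otimes>\<^sub>M lborel)"
        by (simp add: case_prod_beta')
    qed
    also have "\<dots> = (\<integral>\<^sup>+x. ennreal (?g x) * indicator A x \<partial>lborel)"
    proof (rule nn_integral_cong)
      fix x
      have "(\<integral>\<^sup>+y. ennreal (q (x + c - y)) * indicator A x \<partial>P) = (\<integral>\<^sup>+y. ennreal (q (x + c - y)) \<partial>P) * indicator A x"
        by (rule nn_integral_multc) (auto intro: measurable_compose[OF borel_measurable_diff] measurable_ident_sets)
      also have "(\<integral>\<^sup>+y. ennreal (q (x + c - y)) \<partial>P) = ennreal (?g x)"
        using q by (intro nn_integral_eq_integral gI) auto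
      finally show "(\<integral>\<^sup>+y. ennreal (q (x + c - y)) * indicator A x \<partial>P) = ennreal (?g x) * indicator A x" .
    qed
    also have "\<dots> = emeasure (density lborel (\<lambda>x. ennreal (?g x))) A"
      using borel_measurable_continuous_onI[OF gcont] by (subst emeasure_density) auto
    finally show "emeasure Y A = emeasure (density lborel (\<lambda>x. ennreal (?g x))) A" .
  qed
  from cont_density_eqI[OF gcont g0 this] show ?thesis by simp
qed

text \<open>The compound kernel is an expectation under the compound Poisson law, up to the normalising
  constant of the Poisson weights.\<close>

lemma compound_kernel_eq_compound_poisson_integral:
  assumes Q: "finite_measure (Q t)" "sets (Q t) = sets borel"
    and [measurable]: "h \<in> borel_measurable borel" and bd: "\<And>z. \<bar>h z\<bar> \<le> K"
  shows "compound_kernel \<sigma> h \<zeta> Q t x =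
    exp (measure (Q t) UNIV) * (LINT y|compound_poisson (Q t). \<sigma> t * h ((x - y) * \<zeta> t))"
proof -
  let ?l = "measure (Q t) UNIV"
  have "(\<lambda>m. exp (- ?l) / fact m * (LINT y|conv_power (Q t) m. \<sigma> t * h ((x - y) * \<zeta> t)))
     sums (LINT y|compound_poisson (Q t). \<sigma> t * h ((x - y) * \<zeta> t))"
    by (rule integral_compound_poisson[OF Q, where K="\<bar>\<sigma> t\<bar> * K"])
       (use bd in \<open>auto simp: abs_mult intro!: mult_left_mono\<close>)
  from sums_mult[OF this, of "exp ?l"]
  have "(\<lambda>m. 1 / fact m * (LINT y|conv_power (Q t) m. \<sigma> t * h ((x - y) * \<zeta> t)))
     sums (exp ?l * (LINT y|compound_poisson (Q t). \<sigma> t * h ((x - y) * \<zeta> t)))"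
    by (simp add: mult.assoc[symmetric] exp_minus)
  then show ?thesis unfolding compound_kernel_def by (rule sums_unique[symmetric])
qed

section \<open>Decomposition of the law at a fixed time\<close>

context condition_A_measure
begin

context
  fixes a t :: real
  assumes t: "t > 0"
begin

lemma rho_pos: "rho a \<mu> t > 0"
  by (rule rho_properties(1)[OF t])

text \<open>The scale \<open>\<rho>\<^sub>t\<close> is where \<open>t * \<psi>\<^sup>U\<close> is of order one. With these two bounds all later
  constants depend on \<open>\<beta>\<close> alone.\<close>

lemma psiU_rho_bounds: "t * psiU \<mu> (rho a \<mu> t) \<le> 4 * \<beta>" "1 / 2 \<le> t * psiU \<mu> (rho a \<mu> t)"
  using psiU_le_Re_psi[of "rho a \<mu> t" a] Re_psi_le_psiU[of a "rho a \<mu> t"]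
    rho_properties(2)[OF t, of a] t
  by (simp_all add: field_simps)

lemma integrable_large_jumps: "integrable \<mu> (\<lambda>u. t * indicator {u. \<bar>rho a \<mu> t * u\<bar> > 1} u)"
proof (rule Bochner_Integration.integrable_bound)
  show "integrable \<mu> (\<lambda>u. t * min ((rho a \<mu> t * u)\<^sup>2) 1)" using integrable_psiU by (rule integrable_mult_right)
  show "AE u in \<mu>. norm (t * indicator {u. \<bar>rho a \<mu> t * u\<bar> > 1} u) \<le> norm (t * min ((rho a \<mu> t * u)\<^sup>2) 1)"
    using t by (intro AE_I2) (auto split: split_indicator simp: min_def abs_mult dest: abs_square_le_1[THEN iffD1])
qed measurable

lemma sets_Lambda: "sets (Lambda a \<mu> t) = sets borel"
  by (simp add: Lambda_def sets_levy)

lemma emeasure_Lambda: "emeasure (Lambda a \<mu> t) UNIV = ennreal (LINT u|\<mu>. t * indicator {u. \<bar>rho a \<mu> t * u\<bar> > 1} u)"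
proof -
  have "space \<mu> = UNIV" using sets_levy[THEN sets_eq_imp_space_eq] by simp
  then have "emeasure (Lambda a \<mu> t) UNIV = (\<integral>\<^sup>+u. ennreal (t * indicator {u. \<bar>rho a \<mu> t * u\<bar> > 1} u) \<partial>\<mu>)"
    unfolding Lambda_def by (subst emeasure_density) (auto simp: sets_levy)
  also have "\<dots> = ennreal (LINT u|\<mu>. t * indicator {u. \<bar>rho a \<mu> t * u\<bar> > 1} u)"
    using t by (intro nn_integral_eq_integral integrable_large_jumps) auto
  finally show ?thesis .
qed

lemma finite_Lambda: "finite_measure (Lambda a \<mu> t)"
  using sets_Lambda[THEN sets_eq_imp_space_eq] emeasure_Lambda by (intro finite_measureI) simp

lemma measure_Lambda: "measure (Lambda a \<mu> t) UNIV = (LINT u|\<mu>. t * indicator {u. \<bar>rho a \<mu> t * u\<bar> > 1} u)"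
  using t by (intro measure_eq_emeasure_eq_ennreal emeasure_Lambda Bochner_Integration.integral_nonneg) auto

text \<open>The expected number of large jumps up to time \<open>t\<close> is bounded uniformly in \<open>t\<close>. This makes the
  normalising constant of the compound Poisson law harmless.\<close>

lemma measure_Lambda_le: "measure (Lambda a \<mu> t) UNIV \<le> 4 * \<beta>"
proof -
  have "measure (Lambda a \<mu> t) UNIV \<le> (LINT u|\<mu>. t * min ((rho a \<mu> t * u)\<^sup>2) 1)"
    unfolding measure_Lambda
  proof (rule integral_mono[OF integrable_large_jumps])
    show "integrable \<mu> (\<lambda>u. t * min ((rho a \<mu> t * u)\<^sup>2) 1)" using integrable_psiU by (rule integrable_mult_right)
    show "t * indicator {u. \<bar>rho a \<mu> t * u\<bar> > 1} u \<le> t * min ((rho a \<mu> t * u)\<^sup>2) 1" for u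
      using t by (auto split: split_indicator simp: min_def dest: abs_square_le_1[THEN iffD1])
  qed
  also have "\<dots> = t * psiU \<mu> (rho a \<mu> t)" by (simp add: psiU_def)
  also have "\<dots> \<le> 4 * \<beta>" by (rule psiU_rho_bounds)
  finally show ?thesis .
qed

lemma integrable_trunc:
  "integrable \<mu> (\<lambda>u. indicator {u. \<bar>rho a \<mu> t * u\<bar> \<le> 1} u *\<^sub>R (1 - iexp (\<xi> * u) + \<i> * \<xi> * u))"
proof (rule Bochner_Integration.integrable_bound)
  let ?\<rho> = "rho a \<mu> t"
  show "integrable \<mu> (\<lambda>u. \<xi>\<^sup>2 / ?\<rho>\<^sup>2 * min ((?\<rho> * u)\<^sup>2) 1)" using integrable_psiU by (rule integrable_mult_right)
  show "AE u in \<mu>. norm (indicator {u. \<bar>?\<rho> * u\<bar> \<le> 1} u *\<^sub>R (1 - iexp (\<xi> * u) + \<i> * \<xi> * u)) \<le> norm (\<xi>\<^sup>2 / ?\<rho>\<^sup>2 * min ((?\<rho> * u)\<^sup>2) 1)"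
  proof (rule AE_I2)
    fix u
    show "norm (indicator {u. \<bar>?\<rho> * u\<bar> \<le> 1} u *\<^sub>R (1 - iexp (\<xi> * u) + \<i> * \<xi> * u)) \<le> norm (\<xi>\<^sup>2 / ?\<rho>\<^sup>2 * min ((?\<rho> * u)\<^sup>2) 1)"
    proof (cases "\<bar>?\<rho> * u\<bar> \<le> 1")
      case True
      then have "(?\<rho> * u)\<^sup>2 \<le> 1" by (simp add: abs_square_le_1)
      have "norm (1 - iexp (\<xi> * u) + \<i> * \<xi> * u) \<le> (\<xi> * u)\<^sup>2 / 2"
        using norm_compensated_iexp_le[of "\<xi> * u"] by (simp add: mult.assoc)
      also have "\<dots> \<le> (\<xi> * u)\<^sup>2" by simp
      also have "\<dots> = \<xi>\<^sup>2 / ?\<rho>\<^sup>2 * (?\<rho> * u)\<^sup>2" using rho_pos by (simp add: power_mult_distrib)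
      finally show ?thesis using True \<open>(?\<rho> * u)\<^sup>2 \<le> 1\<close> by (simp add: min_def)
    qed simp
  qed
qed measurable

lemma psi_trunc_eq:
  "psi_trunc a \<mu> t \<xi> = (CLINT u|\<mu>. (t * indicator {u. \<bar>rho a \<mu> t * u\<bar> \<le> 1} u) *\<^sub>R (1 - iexp (\<xi> * u) + \<i> * \<xi> * u))"
proof -
  have "psi_trunc a \<mu> t \<xi> = t * (CLINT u|\<mu>. indicator {u. \<bar>rho a \<mu> t * u\<bar> \<le> 1} u *\<^sub>R (1 - iexp (\<xi> * u) + \<i> * \<xi> * u))"
    by (simp add: psi_trunc_def set_lebesgue_integral_def)
  also have "\<dots> = (CLINT u|\<mu>. t * (indicator {u. \<bar>rho a \<mu> t * u\<bar> \<le> 1} u *\<^sub>R (1 - iexp (\<xi> * u) + \<i> * \<xi> * u)))"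
    by (rule integral_mult_right_zero[symmetric])
  finally show ?thesis by (simp add: scaleR_conv_of_real mult.assoc)
qed

text \<open>Discarding the large jumps lowers the real part of the exponent by at most twice their expected
  number.\<close>

lemma Re_psi_trunc_ge: "t * psiU \<mu> \<xi> / (4 * \<beta>) - 8 * \<beta> \<le> Re (psi_trunc a \<mu> t \<xi>)"
proof -
  let ?S = "{u. \<bar>rho a \<mu> t * u\<bar> \<le> 1}" and ?T = "{u. \<bar>rho a \<mu> t * u\<bar> > 1}"
  have IS: "integrable \<mu> (\<lambda>u. indicator ?S u * (1 - cos (\<xi> * u)))"
    by (rule Bochner_Integration.integrable_bound[OF integrable_one_minus_cos[of \<xi>]])
       (auto split: split_indicator)
  have R: "Re (psi_trunc a \<mu> t \<xi>) = t * (LINT u|\<mu>. indicator ?S u * (1 - cos (\<xi> * u)))"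
  proof -
    have "Re (psi_trunc a \<mu> t \<xi>) = t * Re (CLINT u|\<mu>. indicator ?S u *\<^sub>R (1 - iexp (\<xi> * u) + \<i> * \<xi> * u))"
      by (simp add: psi_trunc_def set_lebesgue_integral_def)
    also have "Re (CLINT u|\<mu>. indicator ?S u *\<^sub>R (1 - iexp (\<xi> * u) + \<i> * \<xi> * u)) = (LINT u|\<mu>. indicator ?S u * (1 - cos (\<xi> * u)))"
      by (subst integral_Re[OF integrable_trunc, symmetric]) (simp add: Re_exp)
    finally show ?thesis .
  qed
  have I1: "integrable \<mu> (\<lambda>u. t * (indicator ?S u * (1 - cos (\<xi> * u))))" by (rule integrable_mult_right[OF IS])
  have I2: "integrable \<mu> (\<lambda>u. 2 * (t * indicator ?T u))" by (rule integrable_mult_right[OF integrable_large_jumps])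
  have I3: "integrable \<mu> (\<lambda>u. t * (1 - cos (\<xi> * u)))" by (rule integrable_mult_right[OF integrable_one_minus_cos])
  have "t * Re (psi a \<mu> \<xi>) = (LINT u|\<mu>. t * (1 - cos (\<xi> * u)))"
    by (simp add: Re_psi)
  also have "\<dots> \<le> (LINT u|\<mu>. t * (indicator ?S u * (1 - cos (\<xi> * u))) + 2 * (t * indicator ?T u))"
  proof (intro integral_mono I3 Bochner_Integration.integrable_add I1 I2)
    fix u
    have "1 - cos (\<xi> * u) \<le> 2" using cos_ge_minus_one[of "\<xi> * u"] by linarith
    then have "t * (1 - cos (\<xi> * u)) \<le> t * 2" using t by (intro mult_left_mono) auto
    then show "t * (1 - cos (\<xi> * u)) \<le> t * (indicator ?S u * (1 - cos (\<xi> * u))) + 2 * (t * indicator ?T u)"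
      by (auto split: split_indicator)
  qed
  also have "\<dots> = Re (psi_trunc a \<mu> t \<xi>) + 2 * measure (Lambda a \<mu> t) UNIV"
    unfolding R measure_Lambda
    by (subst Bochner_Integration.integral_add[OF I1 I2]) (simp only: integral_mult_right_zero)
  also have "\<dots> \<le> Re (psi_trunc a \<mu> t \<xi>) + 8 * \<beta>" using measure_Lambda_le by simp
  finally have 1: "t * Re (psi a \<mu> \<xi>) \<le> Re (psi_trunc a \<mu> t \<xi>) + 8 * \<beta>" .
  have "psiU \<mu> \<xi> / (4 * \<beta>) \<le> Re (psi a \<mu> \<xi>)"
    using psiU_le_Re_psi[of \<xi> a] \<beta> by (simp add: divide_le_eq mult.commute)
  then have "t * (psiU \<mu> \<xi> / (4 * \<beta>)) \<le> t * Re (psi a \<mu> \<xi>)" using t by (intro mult_left_mono) auto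
  then show ?thesis using 1 by simp
qed

text \<open>The law of the small jumps exists by the Levy-Khintchine argument applied to \<open>t * \<mu>\<close> restricted
  to \<open>\<bar>\<rho>\<^sub>t * u\<bar> \<le> 1\<close>; by Levy's uniqueness theorem it is the law selected by its exponent. Its exponential moments at the
  scale \<open>\<rho>\<^sub>t\<close> are bounded because \<open>t * \<psi>\<^sup>U(\<rho>\<^sub>t) \<le> 4 * \<beta>\<close>.\<close>

lemma truncated_law:
  obtains N where "real_distribution N" "law_of_exponent (psi_trunc a \<mu> t) = N"
    "\<And>\<xi>. char N \<xi> = exp (- psi_trunc a \<mu> t \<xi>)"
    "(\<integral>\<^sup>+x. exp (rho a \<mu> t * x) \<partial>N) \<le> ennreal (exp (4 * \<beta>))"
    "(\<integral>\<^sup>+x. exp (- rho a \<mu> t * x) \<partial>N) \<le> ennreal (exp (4 * \<beta>))"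
proof -
  let ?\<rho> = "rho a \<mu> t"
  let ?S = "{u. \<bar>?\<rho> * u\<bar> \<le> 1}"
  define \<nu> where "\<nu> = density \<mu> (\<lambda>u. ennreal (t * indicator ?S u))"
  have sets: "sets \<nu> = sets borel" by (simp add: \<nu>_def sets_levy)
  have supp: "AE u in \<nu>. \<bar>?\<rho> * u\<bar> \<le> 1"
    unfolding \<nu>_def by (subst AE_density) (auto split: split_indicator_asm)
  have bd: "(t * indicator ?S u) *\<^sub>R (?\<rho> * u)\<^sup>2 \<le> t * min ((?\<rho> * u)\<^sup>2) 1" for u
    using t by (auto split: split_indicator simp: min_def abs_square_le_1)
  have I: "integrable \<mu> (\<lambda>u. t * min ((?\<rho> * u)\<^sup>2) 1)" using integrable_psiU by (rule integrable_mult_right)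
  have I': "integrable \<mu> (\<lambda>u. (t * indicator ?S u) *\<^sub>R (?\<rho> * u)\<^sup>2)"
    by (rule Bochner_Integration.integrable_bound[OF I]) (use bd t in auto)
  have int: "integrable \<nu> (\<lambda>u. (?\<rho> * u)\<^sup>2)"
    unfolding \<nu>_def using I' t by (subst integrable_density) auto
  have le: "(LINT u|\<nu>. (?\<rho> * u)\<^sup>2) \<le> 4 * \<beta>"
  proof -
    have "(LINT u|\<nu>. (?\<rho> * u)\<^sup>2) = (LINT u|\<mu>. (t * indicator ?S u) *\<^sub>R (?\<rho> * u)\<^sup>2)"
      unfolding \<nu>_def using t by (subst integral_density) auto
    also have "\<dots> \<le> (LINT u|\<mu>. t * min ((?\<rho> * u)\<^sup>2) 1)" by (rule integral_mono[OF I' I bd])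
    also have "\<dots> = t * psiU \<mu> ?\<rho>" by (simp add: psiU_def)
    finally show ?thesis using psiU_rho_bounds by simp
  qed
  have exponent: "(CLINT u|\<nu>. 1 - iexp (\<xi> * u) + \<i> * \<xi> * u) = psi_trunc a \<mu> t \<xi>" for \<xi>
    unfolding psi_trunc_eq \<nu>_def using t by (subst integral_density) auto
  obtain N where N: "real_distribution N" "\<And>\<xi>. char N \<xi> = exp (- (CLINT u|\<nu>. 1 - iexp (\<xi> * u) + \<i> * \<xi> * u))"
    "(\<integral>\<^sup>+x. exp (?\<rho> * x) \<partial>N) \<le> ennreal (exp (LINT u|\<nu>. (?\<rho> * u)\<^sup>2))"
    "(\<integral>\<^sup>+x. exp (- ?\<rho> * x) \<partial>N) \<le> ennreal (exp (LINT u|\<nu>. (?\<rho> * u)\<^sup>2))"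
    using compensated_law_exists[OF sets rho_pos supp int] by blast
  have le': "ennreal (exp (LINT u|\<nu>. (?\<rho> * u)\<^sup>2)) \<le> ennreal (exp (4 * \<beta>))"
    using le by (intro ennreal_leI) simp
  have charN: "char N \<xi> = exp (- psi_trunc a \<mu> t \<xi>)" for \<xi> using N(2) exponent by simp
  have "law_of_exponent (psi_trunc a \<mu> t) = N"
    unfolding law_of_exponent_def
  proof (rule the_equality)
    show "real_distribution N \<and> (\<forall>\<xi>. char N \<xi> = exp (- psi_trunc a \<mu> t \<xi>))" using N(1) charN by simp
    fix N' assume "real_distribution N' \<and> (\<forall>\<xi>. char N' \<xi> = exp (- psi_trunc a \<mu> t \<xi>))"
    then show "N' = N" using N(1) charN by (intro Levy_uniqueness) auto
  qed
  from that[OF N(1) this charN] N(3,4) le' show ?thesis by (meson order_trans)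
qed

text \<open>Small jumps are fully compensated in the truncated exponent, large jumps not at all; the difference
  to the compensation on \<open>\<bar>u\<bar> < 1\<close> in \<open>\<psi>\<close> is a drift, and it is the centering.\<close>

lemma exponent_decomposition:
  "t * psi a \<mu> \<xi> = psi_trunc a \<mu> t \<xi> + (measure (Lambda a \<mu> t) UNIV - char (Lambda a \<mu> t) \<xi>) + \<i> * \<xi> * centering a \<mu> t"
proof -
  let ?\<rho> = "rho a \<mu> t"
  let ?S = "{u. \<bar>?\<rho> * u\<bar> \<le> 1}" and ?T = "{u. \<bar>?\<rho> * u\<bar> > 1}" and ?U = "{u::real. \<bar>u\<bar> < 1}"
  \<comment> \<open>both branches of the centering integrate this function\<close>
  define d where "d u = u * (indicator ?U u - indicator ?S u)" for u :: real
  have iff: "\<bar>?\<rho> * u\<bar> \<le> 1 \<longleftrightarrow> \<bar>u\<bar> \<le> 1 / ?\<rho>" for u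
    using rho_pos by (simp add: abs_mult field_simps)
  \<comment> \<open>\<open>d\<close> lives where \<open>1 / \<rho>\<^sub>t < \<bar>u\<bar> < 1\<close>, with \<open>\<bar>u\<bar> \<le> \<rho>\<^sub>t\<^sup>2 * u\<^sup>2\<close>, or where \<open>1 \<le> \<bar>u\<bar> \<le> 1 / \<rho>\<^sub>t\<close>\<close>
  have Id: "integrable \<mu> d"
  proof (rule integrable_levy_bounded[where C="?\<rho>\<^sup>2 + 1 / ?\<rho>"])
    show "d \<in> borel_measurable borel" unfolding d_def by measurable
    fix u :: real
    show "norm (d u) \<le> (?\<rho>\<^sup>2 + 1 / ?\<rho>) * min 1 (u\<^sup>2)"
    proof (cases "\<bar>u\<bar> < 1")
      case True
      then have m: "min 1 (u\<^sup>2) = u\<^sup>2" using abs_square_less_1[of u] by (simp add: min_def)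
      have "norm (d u) \<le> ?\<rho>\<^sup>2 * u\<^sup>2"
      proof (cases "\<bar>?\<rho> * u\<bar> \<le> 1")
        case False
        then have "1 \<le> (?\<rho> * u)\<^sup>2" using abs_square_le_1[of "?\<rho> * u"] by linarith
        then show ?thesis using True False by (simp add: d_def power_mult_distrib)
      qed (use True in \<open>simp add: d_def\<close>)
      also have "\<dots> \<le> (?\<rho>\<^sup>2 + 1 / ?\<rho>) * u\<^sup>2" using rho_pos by (intro mult_right_mono) auto
      finally show ?thesis using m by simp
    next
      case False
      then have m: "min 1 (u\<^sup>2) = 1" using abs_square_less_1[of u] by (simp add: min_def)
      have "norm (d u) \<le> 1 / ?\<rho>"
        using False rho_pos by (cases "\<bar>?\<rho> * u\<bar> \<le> 1") (auto simp: d_def iff)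
      also have "\<dots> \<le> ?\<rho>\<^sup>2 + 1 / ?\<rho>" by simp
      finally show ?thesis using m by simp
    qed
  qed
  have cent: "centering a \<mu> t = t * (a + (LINT u|\<mu>. d u))"
  proof (cases "?\<rho> > 1")
    case True
    then have "1 / ?\<rho> < 1" by simp
    then have "indicator {u. 1 / ?\<rho> < \<bar>u\<bar> \<and> \<bar>u\<bar> < 1} u *\<^sub>R u = d u" for u
      by (auto simp: d_def iff split: split_indicator)
    then show ?thesis using True by (simp add: centering_def set_lebesgue_integral_def)
  next
    case False
    then have "1 / ?\<rho> \<ge> 1" using rho_pos by simp
    then have "- (indicator {u. 1 \<le> \<bar>u\<bar> \<and> \<bar>u\<bar> \<le> 1 / ?\<rho>} u *\<^sub>R u) = d u" for u
      by (auto simp: d_def iff split: split_indicator)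
    then have "- (LINT u|\<mu>. indicator {u. 1 \<le> \<bar>u\<bar> \<and> \<bar>u\<bar> \<le> 1 / ?\<rho>} u *\<^sub>R u) = (LINT u|\<mu>. d u)"
      by (subst Bochner_Integration.integral_minus[symmetric]) simp
    then show ?thesis using False by (simp add: centering_def set_lebesgue_integral_def)
  qed
  interpret L: finite_measure "Lambda a \<mu> t" by (rule finite_Lambda)
  have [measurable_cong]: "sets (Lambda a \<mu> t) = sets borel" by (rule sets_Lambda)
  have spL: "space (Lambda a \<mu> t) = UNIV" using sets_Lambda[THEN sets_eq_imp_space_eq] by simp
  have IL: "integrable (Lambda a \<mu> t) (\<lambda>u. iexp (\<xi> * u))"
    by (rule L.integrable_const_bound[where B=1]) auto
  then have IL2: "integrable (Lambda a \<mu> t) (\<lambda>u. 1 - iexp (\<xi> * u))"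
    by (intro Bochner_Integration.integrable_diff L.integrable_const)
  have "measure (Lambda a \<mu> t) UNIV - char (Lambda a \<mu> t) \<xi> = (CLINT u|Lambda a \<mu> t. 1 - iexp (\<xi> * u))"
    unfolding char_def using IL by (subst Bochner_Integration.integral_diff) (auto simp: spL scaleR_conv_of_real)
  also have "\<dots> = (CLINT u|\<mu>. (t * indicator ?T u) *\<^sub>R (1 - iexp (\<xi> * u)))"
    unfolding Lambda_def using t by (subst integral_density) auto
  finally have lam: "measure (Lambda a \<mu> t) UNIV - char (Lambda a \<mu> t) \<xi> = (CLINT u|\<mu>. (t * indicator ?T u) *\<^sub>R (1 - iexp (\<xi> * u)))" .
  have IL': "integrable \<mu> (\<lambda>u. (t * indicator ?T u) *\<^sub>R (1 - iexp (\<xi> * u)))"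
    using IL2 t unfolding Lambda_def by (subst (asm) integrable_density) auto
  have IS': "integrable \<mu> (\<lambda>u. (t * indicator ?S u) *\<^sub>R (1 - iexp (\<xi> * u) + \<i> * \<xi> * u))"
    using integrable_scaleR_right[OF integrable_trunc, of t \<xi>] by simp
  have Id': "integrable \<mu> (\<lambda>u. \<i> * \<xi> * t * complex_of_real (d u))" using Id by (intro integrable_mult_right) simp
  have "t * (CLINT u|\<mu>. 1 - iexp (\<xi> * u) + \<i> * \<xi> * u * indicator ?U u) =
    (CLINT u|\<mu>. t * (1 - iexp (\<xi> * u) + \<i> * \<xi> * u * indicator ?U u))"
    by (rule integral_mult_right_zero[symmetric])
  also have "\<dots> = (CLINT u|\<mu>. (t * indicator ?S u) *\<^sub>R (1 - iexp (\<xi> * u) + \<i> * \<xi> * u)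
       + (t * indicator ?T u) *\<^sub>R (1 - iexp (\<xi> * u)) + \<i> * \<xi> * t * complex_of_real (d u))"
  proof (rule Bochner_Integration.integral_cong[OF refl])
    fix u :: real
    show "t * (1 - iexp (\<xi> * u) + \<i> * \<xi> * u * indicator ?U u) =
      (t * indicator ?S u) *\<^sub>R (1 - iexp (\<xi> * u) + \<i> * \<xi> * u)
       + (t * indicator ?T u) *\<^sub>R (1 - iexp (\<xi> * u)) + \<i> * \<xi> * t * complex_of_real (d u)"
      by (cases "\<bar>?\<rho> * u\<bar> \<le> 1"; cases "\<bar>u\<bar> < 1") (simp_all add: d_def scaleR_conv_of_real ring_distribs)
  qed
  also have "\<dots> = psi_trunc a \<mu> t \<xi> + (measure (Lambda a \<mu> t) UNIV - char (Lambda a \<mu> t) \<xi>) + \<i> * \<xi> * t * (LINT u|\<mu>. d u)"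
    unfolding lam psi_trunc_eq using IL' IS' Id'
    by (subst Bochner_Integration.integral_add, (auto)[2], subst Bochner_Integration.integral_add) auto
  finally have "t * (CLINT u|\<mu>. 1 - iexp (\<xi> * u) + \<i> * \<xi> * u * indicator ?U u) = \<dots>" .
  then show ?thesis unfolding psi_def cent by (simp add: algebra_simps)
qed

end

text \<open>Uniform in \<open>t\<close> after rescaling by \<open>\<rho>\<^sub>t\<close>. On the dyadic block \<open>2 ^ n \<le> \<bar>\<xi>\<bar> / \<rho>\<^sub>t < 2 ^ Suc n\<close> the exponent is at
  least of order \<open>\<theta> ^ n\<close> with \<open>\<theta> > 1\<close>, and a double exponential beats the factor \<open>16 ^ n\<close> that comes from the
  denominator.\<close>

lemma char_truncated_law_decay:
  obtains K :: real where "K > 0"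
    "\<And>t \<xi>. t > 0 \<Longrightarrow> norm (exp (- psi_trunc a \<mu> t \<xi>)) \<le> K / (1 + (\<xi> / rho a \<mu> t)\<^sup>2)\<^sup>2"
proof -
  define \<theta> where "\<theta> = 1 / (1 - 3 / (4 * \<beta>))"
  have \<theta>: "\<theta> > 1" unfolding \<theta>_def by (rule growth_factor_gt_1)
  obtain S where S: "S \<ge> 0" "\<And>n. 16 ^ n * exp (- (1 / (8 * \<beta>)) * \<theta> ^ n) \<le> S"
    using geometric_vs_double_exponential[OF \<theta>, of "1 / (8 * \<beta>)"] \<beta> by auto
  \<comment> \<open>\<open>exp (8 * \<beta>)\<close> pays for the discarded large jumps, 4 covers \<open>\<bar>\<xi>\<bar> < \<rho>\<^sub>t\<close>, and \<open>64 * S\<close> the dyadic blocks\<close>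
  define K where "K = exp (8 * \<beta>) * (4 + 64 * S)"
  show ?thesis
  proof (rule that[of K])
    show "K > 0" using S by (simp add: K_def add_pos_nonneg)
    fix t \<xi> :: real assume t: "t > 0"
    let ?\<rho> = "rho a \<mu> t"
    note \<rho> = rho_properties(1)[OF t, of a]
    define s where "s = \<bar>\<xi> / ?\<rho>\<bar>"
    have s0: "s \<ge> 0" by (simp add: s_def)
    have "1 + s\<^sup>2 > 0" by (simp add: add_pos_nonneg)
    then have P: "(1 + s\<^sup>2)\<^sup>2 > 0" by simp
    have U0: "psiU \<mu> \<xi> \<ge> 0" unfolding psiU_def by (rule Bochner_Integration.integral_nonneg) auto
    have "exp (- (t * psiU \<mu> \<xi> / (4 * \<beta>))) * (1 + s\<^sup>2)\<^sup>2 \<le> 4 + 64 * S"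
    proof (cases "s < 1")
      case True
      have "s\<^sup>2 \<le> 1" using True s0 by (simp add: abs_square_le_1)
      then have "(1 + s\<^sup>2)\<^sup>2 \<le> 2\<^sup>2" by (intro power_mono) auto
      moreover have "exp (- (t * psiU \<mu> \<xi> / (4 * \<beta>))) \<le> 1" using U0 t \<beta> by simp
      ultimately have "exp (- (t * psiU \<mu> \<xi> / (4 * \<beta>))) * (1 + s\<^sup>2)\<^sup>2 \<le> 1 * 2\<^sup>2" by (intro mult_mono) auto
      then show ?thesis using S(1) by simp
    next
      case False
      obtain n where n: "2 ^ n \<le> s" "s < 2 ^ Suc n"
      proof -
        define m where "m = (LEAST m. s < 2 ^ m)"
        have ex: "\<exists>m. s < 2 ^ m" using real_arch_pow[of 2 s] by auto
        have m: "s < 2 ^ m" unfolding m_def using ex by (rule LeastI_ex)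
        then have "m \<noteq> 0" using False by (cases m) auto
        then obtain n where n: "m = Suc n" by (cases m) auto
        then have "\<not> s < 2 ^ n" unfolding m_def using not_less_Least by (metis lessI)
        then show ?thesis using that[of n] m n by auto
      qed
      have "\<theta> ^ n / 2 \<le> t * psiU \<mu> \<xi>"
      proof -
        have "\<theta> ^ n / 2 \<le> \<theta> ^ n * (t * psiU \<mu> ?\<rho>)"
          using psiU_rho_bounds(2)[OF t, of a] \<theta> mult_left_mono[of "1/2" "t * psiU \<mu> ?\<rho>" "\<theta> ^ n"] by simp
        also have "\<dots> = t * (\<theta> ^ n * psiU \<mu> ?\<rho>)" by simp
        also have "\<dots> \<le> t * psiU \<mu> (2 ^ n * ?\<rho>)"
          using psiU_geometric_growth[of n ?\<rho>] t unfolding \<theta>_def by (intro mult_left_mono) auto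
        also have "\<dots> \<le> t * psiU \<mu> \<xi>"
        proof (intro mult_left_mono psiU_mono)
          have "2 ^ n * ?\<rho> \<le> s * ?\<rho>" using n \<rho> by (intro mult_right_mono) auto
          also have "\<dots> = \<bar>\<xi>\<bar>" using \<rho> by (simp add: s_def abs_divide)
          finally show "\<bar>2 ^ n * ?\<rho>\<bar> \<le> \<bar>\<xi>\<bar>" using \<rho> by (simp add: abs_mult)
        qed (use t in simp)
        finally show ?thesis .
      qed
      then have "\<theta> ^ n / 2 / (4 * \<beta>) \<le> t * psiU \<mu> \<xi> / (4 * \<beta>)" using \<beta> by (intro divide_right_mono) auto
      then have e: "exp (- (t * psiU \<mu> \<xi> / (4 * \<beta>))) \<le> exp (- (1 / (8 * \<beta>)) * \<theta> ^ n)" by simp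
      have "(1 + s\<^sup>2)\<^sup>2 \<le> 64 * 16 ^ n"
      proof -
        have "s\<^sup>2 \<le> (2 ^ Suc n)\<^sup>2" using n s0 by (intro power_mono) auto
        moreover have "1 \<le> (2 ^ Suc n :: real)\<^sup>2" by (rule one_le_power) (rule two_realpow_ge_one)
        ultimately have "(1 + s\<^sup>2)\<^sup>2 \<le> (2 * (2 ^ Suc n)\<^sup>2)\<^sup>2" by (intro power_mono) auto
        also have "\<dots> = 64 * 16 ^ n"
        proof -
          have "(2 ^ n) ^ 4 = ((2::real) ^ 4) ^ n" by (simp only: power_mult[symmetric] mult.commute)
          then have "(16::real) ^ n = (2 ^ n) ^ 4" by simp
          then show ?thesis by (simp add: power_mult_distrib eval_nat_numeral)
        qed
        finally show ?thesis .
      qed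
      then have "exp (- (t * psiU \<mu> \<xi> / (4 * \<beta>))) * (1 + s\<^sup>2)\<^sup>2 \<le> exp (- (1 / (8 * \<beta>)) * \<theta> ^ n) * (64 * 16 ^ n)"
        using e by (intro mult_mono) auto
      also have "\<dots> = 64 * (16 ^ n * exp (- (1 / (8 * \<beta>)) * \<theta> ^ n))" by simp
      also have "\<dots> \<le> 64 * S" using S(2) by (intro mult_left_mono) auto
      finally show ?thesis by simp
    qed
    then have main: "exp (- (t * psiU \<mu> \<xi> / (4 * \<beta>))) \<le> (4 + 64 * S) / (1 + s\<^sup>2)\<^sup>2"
      using P by (simp add: pos_le_divide_eq)
    have "norm (exp (- psi_trunc a \<mu> t \<xi>)) \<le> exp (8 * \<beta> - t * psiU \<mu> \<xi> / (4 * \<beta>))"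
      using Re_psi_trunc_ge[OF t, of \<xi> a] by simp
    also have "\<dots> = exp (8 * \<beta>) * exp (- (t * psiU \<mu> \<xi> / (4 * \<beta>)))" by (simp add: mult_exp_exp)
    also have "\<dots> \<le> exp (8 * \<beta>) * ((4 + 64 * S) / (1 + s\<^sup>2)\<^sup>2)" using main by (intro mult_left_mono) auto
    also have "\<dots> = K / (1 + (\<xi> / ?\<rho>)\<^sup>2)\<^sup>2" by (simp add: K_def s_def del: abs_divide)
    finally show "norm (exp (- psi_trunc a \<mu> t \<xi>)) \<le> K / (1 + (\<xi> / ?\<rho>)\<^sup>2)\<^sup>2" .
  qed
qed

end

section \<open>The compound kernel estimates\<close>

theorem theorem2p2:
  fixes M :: "'a measure" and Z :: "real \<Rightarrow> 'a \<Rightarrow> real"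
    and a :: real and \<mu> :: "real measure" and p :: "real \<Rightarrow> real \<Rightarrow> real"
  assumes "levy_process M Z"
    and "levy_measure \<mu>"
    and "\<And>t \<xi>. t \<ge> 0 \<Longrightarrow> char (distr M borel (Z t)) \<xi> = exp (- (t * psi a \<mu> \<xi>))"
    and "emeasure \<mu> UNIV = \<infinity>"
    and "condition_A \<mu>"
  defines "p \<equiv> \<lambda>t. cont_density (distr M borel (Z t))"
  shows "\<forall>t0>0. \<exists>b1>0. \<exists>b2>0. \<exists>b3>0. \<exists>b4>0.
    upper_compound_kernel_estimate ({0<..t0} \<times> UNIV)
      (\<lambda>t x. p t (x - centering a \<mu> t))
      (rho a \<mu>) (\<lambda>x. b1 * exp (- b2 * \<bar>x\<bar>)) (rho a \<mu>) (Lambda a \<mu>) \<and>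
    lower_compound_kernel_estimate ({0<..t0} \<times> UNIV)
      (\<lambda>t x. p t (x - centering a \<mu> t + mode_point a \<mu> t))
      (rho a \<mu>) (\<lambda>x. b3 * indicator {x. \<bar>x\<bar> \<le> b4} x) (rho a \<mu>) (Lambda a \<mu>)"
proof -
  obtain \<beta> where \<beta>: "\<beta> > 1" "\<And>\<xi>. psiU \<mu> \<xi> \<le> \<beta> * psiL \<mu> \<xi>"
    using assms(5) by (auto simp: condition_A_def)
  interpret condition_A_measure \<mu> \<beta>
    by unfold_locales (use assms \<beta> in auto)
  interpret M: prob_space M using assms(1) by (simp add: levy_process_def)
  obtain K :: real where K: "K > 0"
    "\<And>t \<xi>. t > 0 \<Longrightarrow> norm (exp (- psi_trunc a \<mu> t \<xi>)) \<le> K / (1 + (\<xi> / rho a \<mu> t)\<^sup>2)\<^sup>2"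
    using char_truncated_law_decay[of a] by blast
  obtain B L where BL: "B > 0" "L > 0"
    "\<And>N r. \<lbrakk>real_distribution N; r > 0; \<And>\<xi>. norm (char N \<xi>) \<le> K / (1 + (\<xi> / r)\<^sup>2)\<^sup>2\<rbrakk> \<Longrightarrow>
      \<exists>q. continuous_on UNIV q \<and> (\<forall>x. 0 \<le> q x) \<and> N = density lborel (\<lambda>x. ennreal (q x)) \<and>
        (\<forall>x. q x \<le> B * r) \<and> (\<forall>x y. \<bar>q x - q y\<bar> \<le> L * r\<^sup>2 * \<bar>x - y\<bar>)"
    using density_of_char_bound[OF K(1)] by blast
  define E where "E = exp (4 * \<beta>)"
  have E: "E \<ge> 1" using \<beta> by (simp add: E_def)
  define b1 where "b1 = sqrt (2 * L * E * exp (B / (2 * L)))"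
  \<comment> \<open>the peak of the density of the small jumps is at least \<open>c * \<rho>\<^sub>t\<close>\<close>
  define c where "c = 1 / (4 * ln (4 * E))"
  \<comment> \<open>half of the peak, divided by the bound \<open>exp (4 * \<beta>)\<close> of \<open>exp \<Lambda>\<^sub>t(\<real>)\<close>\<close>
  define b3 where "b3 = exp (- (4 * \<beta>)) * (c / 2)"
  \<comment> \<open>within \<open>b4 / \<rho>\<^sub>t\<close> of the mode the Lipschitz bound keeps the density above half of its peak\<close>
  define b4 where "b4 = c / (2 * L)"
  have pos: "b1 > 0" "c > 0" "b3 > 0" "b4 > 0"
    using BL E by (auto simp: b1_def c_def b3_def b4_def)
  have main: "p t (x - centering a \<mu> t) \<le> compound_kernel (rho a \<mu>) (\<lambda>x. b1 * exp (- (1 / 2) * \<bar>x\<bar>)) (rho a \<mu>) (Lambda a \<mu>) t x \<and>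
     compound_kernel (rho a \<mu>) (\<lambda>x. b3 * indicator {x. \<bar>x\<bar> \<le> b4} x) (rho a \<mu>) (Lambda a \<mu>) t x
       \<le> p t (x - centering a \<mu> t + mode_point a \<mu> t)" if t: "t > 0" for t x
  proof -
    let ?\<rho> = "rho a \<mu> t" and ?\<Lambda> = "Lambda a \<mu> t"
    note \<rho> = rho_pos[OF t, of a]
    obtain N where N: "real_distribution N" "law_of_exponent (psi_trunc a \<mu> t) = N"
      "\<And>\<xi>. char N \<xi> = exp (- psi_trunc a \<mu> t \<xi>)"
      "(\<integral>\<^sup>+x. exp (?\<rho> * x) \<partial>N) \<le> ennreal E" "(\<integral>\<^sup>+x. exp (- ?\<rho> * x) \<partial>N) \<le> ennreal E"
      using truncated_law[OF t, of a] unfolding E_def by blast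
    have "norm (char N \<xi>) \<le> K / (1 + (\<xi> / ?\<rho>)\<^sup>2)\<^sup>2" for \<xi>
      unfolding N(3) by (rule K(2)[OF t])
    from BL(3)[OF N(1) \<rho> this] obtain q where q: "continuous_on UNIV q" "\<And>x. 0 \<le> q x"
      "N = density lborel (\<lambda>x. ennreal (q x))" "\<And>x. q x \<le> B * ?\<rho>"
      "\<And>x y. \<bar>q x - q y\<bar> \<le> L * ?\<rho>\<^sup>2 * \<bar>x - y\<bar>" by blast
    have qm[measurable]: "q \<in> borel_measurable borel" by (rule borel_measurable_continuous_onI[OF q(1)])
    have pbar: "pbar a \<mu> t = q"
      unfolding pbar_def N(2) by (rule cont_density_eqI[OF q(1-3)])
    have decay: "q z \<le> ?\<rho> * (b1 * exp (- (\<bar>?\<rho> * z\<bar> / 2)))" for z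
      unfolding b1_def using density_decay[OF N(1) q(3) qm q(2) \<rho> BL(1,2) _ q(4,5) N(4,5)] E by simp
    have mode: "q z \<le> q (mode_point a \<mu> t)" for z
    proof -
      obtain x0 where x0: "q x0 > 0"
      proof (rule ccontr)
        assume "\<not> thesis"
        then have "q x \<le> 0" for x using that by (meson not_le)
        then have "N = density lborel (\<lambda>_. 0)" using q(3) by (simp add: ennreal_neg)
        then have "emeasure N UNIV = 0" by (simp add: emeasure_density)
        moreover have "emeasure N UNIV = 1"
          using N(1) by (metis prob_space.emeasure_space_1 real_distribution.axioms(1) real_distribution.space_eq_univ)
        ultimately show False by simp
      qed
      have "q z * \<bar>z\<bar> \<le> 2 * b1" for z
      proof -
        have le_exp: "\<bar>?\<rho> * z\<bar> / 2 \<le> exp (\<bar>?\<rho> * z\<bar> / 2)" using exp_ge_add_one_self[of "\<bar>?\<rho> * z\<bar> / 2"] by linarith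
        have "q z * \<bar>z\<bar> \<le> ?\<rho> * (b1 * exp (- (\<bar>?\<rho> * z\<bar> / 2))) * \<bar>z\<bar>"
          by (intro mult_right_mono decay) auto
        also have "\<dots> = 2 * b1 * (exp (- (\<bar>?\<rho> * z\<bar> / 2)) * (\<bar>?\<rho> * z\<bar> / 2))" using \<rho> by (simp add: abs_mult)
        also have "\<dots> \<le> 2 * b1 * (exp (- (\<bar>?\<rho> * z\<bar> / 2)) * exp (\<bar>?\<rho> * z\<bar> / 2))"
          using pos by (intro mult_left_mono le_exp) auto
        also have "\<dots> = 2 * b1" by (simp add: mult_exp_exp)
        finally show ?thesis .
      qed
      from least_maximiser[OF q(1) x0 this] show ?thesis by (simp add: mode_point_def pbar)
    qed
    have mode_ge: "c * ?\<rho> \<le> q (mode_point a \<mu> t)"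
      using max_density_lower_bound[OF N(1) q(3) qm \<rho> E N(4,5) mode] by (simp add: c_def)
    have near: "c / 2 * ?\<rho> \<le> q (z + mode_point a \<mu> t)" if "\<bar>z * ?\<rho>\<bar> \<le> b4" for z
    proof -
      have "q (mode_point a \<mu> t) - q (z + mode_point a \<mu> t) \<le> L * ?\<rho>\<^sup>2 * \<bar>z\<bar>"
        using q(5)[of "mode_point a \<mu> t" "z + mode_point a \<mu> t"] by simp
      also have "\<dots> = L * ?\<rho> * \<bar>z * ?\<rho>\<bar>" using \<rho> by (simp add: power2_eq_square abs_mult)
      also have "\<dots> \<le> L * ?\<rho> * b4" using that BL \<rho> by (intro mult_left_mono) auto
      also have "\<dots> = c / 2 * ?\<rho>" using BL by (simp add: b4_def)
      finally show ?thesis using mode_ge by simp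
    qed
    define P where "P = compound_poisson ?\<Lambda>"
    have P: "real_distribution P"
      unfolding P_def by (rule real_distribution_compound_poisson[OF finite_Lambda[OF t] sets_Lambda[OF t]])
    interpret P: real_distribution P by (rule P)
    have charP: "char P \<xi> = exp (char ?\<Lambda> \<xi> - measure ?\<Lambda> UNIV)" for \<xi>
      unfolding P_def by (rule char_compound_poisson[OF finite_Lambda[OF t] sets_Lambda[OF t]])
    have Zt: "Z t \<in> borel_measurable M" using assms(1) t by (simp add: levy_process_def)
    have Y: "real_distribution (distr M borel (Z t))"
      using Zt by (auto simp: real_distribution_def real_distribution_axioms_def intro!: M.prob_space_distr)
    have charY: "char (distr M borel (Z t)) \<xi> = iexp (- (\<xi> * centering a \<mu> t)) * char N \<xi> * char P \<xi>" for \<xi>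
      using t unfolding N(3) charP assms(3)[OF less_imp_le[OF t]] exponent_decomposition[OF t]
      by (simp add: mult_exp_exp algebra_simps)
    have pt: "p t z = (LINT y|P. q (z + centering a \<mu> t - y))" for z
      unfolding p_def by (rule cont_density_convolution_shift[OF N(1) q(3) P q(1,2,4) Y charY])
    have Iq: "integrable P (\<lambda>y. q (z - y))" for z
      by (rule P.integrable_const_bound[where B="B * ?\<rho>"]) (use q in auto)
    have mL: "0 \<le> measure ?\<Lambda> UNIV" "measure ?\<Lambda> UNIV \<le> 4 * \<beta>" using measure_Lambda_le[OF t] by auto
    let ?hu = "\<lambda>x. b1 * exp (- (1 / 2) * \<bar>x\<bar>)" and ?hl = "\<lambda>x. b3 * indicator {x. \<bar>x\<bar> \<le> b4} x :: real"
    have hu: "\<bar>?hu z\<bar> \<le> b1" for z using pos by (simp add: abs_mult mult_le_cancel_left1)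
    have hl: "\<bar>?hl z\<bar> \<le> b3" for z using pos by (auto split: split_indicator)
    have scaled: "norm (?\<rho> * v) \<le> ?\<rho> * C" if "\<bar>v\<bar> \<le> C" for v C :: real
      using that \<rho> by (simp add: abs_mult)
    have Iu: "integrable P (\<lambda>y. ?\<rho> * ?hu ((x - y) * ?\<rho>))"
    proof (rule P.integrable_const_bound[where B="?\<rho> * b1"])
      show "AE y in P. norm (?\<rho> * ?hu ((x - y) * ?\<rho>)) \<le> ?\<rho> * b1"
        by (rule AE_I2, rule scaled, rule hu)
    qed measurable
    have Il: "integrable P (\<lambda>y. ?\<rho> * ?hl ((x - y) * ?\<rho>))"
    proof (rule P.integrable_const_bound[where B="?\<rho> * b3"])
      show "AE y in P. norm (?\<rho> * ?hl ((x - y) * ?\<rho>)) \<le> ?\<rho> * b3"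
        by (rule AE_I2, rule scaled, rule hl)
    qed measurable
    have "p t (x - centering a \<mu> t) = (LINT y|P. q (x - y))" by (simp add: pt)
    also have "\<dots> \<le> (LINT y|P. ?\<rho> * ?hu ((x - y) * ?\<rho>))"
    proof (rule integral_mono[OF Iq Iu])
      show "q (x - y) \<le> ?\<rho> * ?hu ((x - y) * ?\<rho>)" for y
        using decay[of "x - y"] by (simp add: mult.commute)
    qed
    also have "\<dots> \<le> exp (measure ?\<Lambda> UNIV) * (LINT y|P. ?\<rho> * ?hu ((x - y) * ?\<rho>))"
    proof -
      have nonneg: "0 \<le> (LINT y|P. ?\<rho> * ?hu ((x - y) * ?\<rho>))"
        using \<rho> pos by (intro Bochner_Integration.integral_nonneg) auto
      have "1 \<le> exp (measure ?\<Lambda> UNIV)" using mL by simp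
      from mult_right_mono[OF this nonneg] show ?thesis by (simp only: mult_1)
    qed
    also have "\<dots> = compound_kernel (rho a \<mu>) ?hu (rho a \<mu>) (Lambda a \<mu>) t x"
      unfolding P_def
      by (rule compound_kernel_eq_compound_poisson_integral[symmetric, where Q = "Lambda a \<mu>" and t = t and K = b1])
         (simp_all only: finite_Lambda[OF t] sets_Lambda[OF t] hu, measurable)
    finally have upper: "p t (x - centering a \<mu> t) \<le> compound_kernel (rho a \<mu>) ?hu (rho a \<mu>) (Lambda a \<mu>) t x" .
    have "compound_kernel (rho a \<mu>) ?hl (rho a \<mu>) (Lambda a \<mu>) t x = exp (measure ?\<Lambda> UNIV) * (LINT y|P. ?\<rho> * ?hl ((x - y) * ?\<rho>))"
      unfolding P_def
      by (rule compound_kernel_eq_compound_poisson_integral[where Q = "Lambda a \<mu>" and t = t and K = b3])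
         (simp_all only: finite_Lambda[OF t] sets_Lambda[OF t] hl, measurable)
    also have "\<dots> = (LINT y|P. exp (measure ?\<Lambda> UNIV) * (?\<rho> * ?hl ((x - y) * ?\<rho>)))" by (rule integral_mult_right_zero[symmetric])
    also have "\<dots> \<le> (LINT y|P. q (x + mode_point a \<mu> t - y))"
    proof (rule integral_mono[OF integrable_mult_right[OF Il] Iq])
      fix y
      show "exp (measure ?\<Lambda> UNIV) * (?\<rho> * ?hl ((x - y) * ?\<rho>)) \<le> q (x + mode_point a \<mu> t - y)"
      proof (cases "\<bar>(x - y) * ?\<rho>\<bar> \<le> b4")
        case True
        have "exp (measure ?\<Lambda> UNIV) * (?\<rho> * b3) = exp (measure ?\<Lambda> UNIV - 4 * \<beta>) * (c / 2 * ?\<rho>)"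
          by (simp add: b3_def exp_diff exp_minus field_simps)
        also have "\<dots> \<le> 1 * (c / 2 * ?\<rho>)" using mL \<rho> pos by (intro mult_right_mono) auto
        also have "\<dots> \<le> q ((x - y) + mode_point a \<mu> t)" using near[OF True] by simp
        finally show ?thesis using True by (simp add: algebra_simps)
      qed (use q(2) in simp)
    qed
    also have "\<dots> = p t (x - centering a \<mu> t + mode_point a \<mu> t)" by (simp add: pt algebra_simps)
    finally show ?thesis using upper by blast
  qed
  show ?thesis
    unfolding upper_compound_kernel_estimate_def lower_compound_kernel_estimate_def
    using main pos
    by (intro allI impI exI[of _ b1] exI[of _ "1 / 2"] exI[of _ b3] exI[of _ b4] conjI) auto
qed

end
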